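(* For any choice of points $q_1,\dots,q_7\in\mathbb{R}^2$ in convex position, the rows of the cofactor matrix $C_4(q_1,\dots,q_7)$ realize $\overline{\Delta}_2(7)$ as a complete fan.
   Context: An edge is an element of $\binom{[n]}{2}$. Two disjoint edges $\{i,j\},\{a,b\}$ with $i<j$, $a<b$ cross if $i<a<j<b$ or $a<i<b<j$. The length of $\{i,j\}$ is $\min\{|j-i|,n-|j-i|\}$. $\overline{\Delta}_k(n)$ is the simplicial complex whose vertices are the edges of length at least $k+1$ and whose faces are the sets of such edges containing no $k+1$ pairwise crossing edges; it is a sphere of dimension $k(n-2k-1)-1$. Convex position: $q_1,\dots,q_n$ are the distinct vertices of a convex $n$-gon, in this cyclic order. $C_d(\mathbf q)$ has one row per edge $\{i,j\}$, $i<j$, and one block of $d$ columns per vertex; with $q_i=(x_i,y_i)$, the row of $\{i,j\}$ has $\mathbf c_{ij}$ in block $i$, $-\mathbf c_{ij}$ in block $j$, zeros elsewhere, where $\mathbf c_{ij}=\big((x_i-x_j)^{d-1},(y_i-y_j)(x_i-x_j)^{d-2},\dots,(y_i-y_j)^{d-1}\big)$. Realizing as a complete fan: let $(v_e)_{e\in\binom{[n]}{2}}$ be vectors, $W$ their linear span, $W'$ the quotient of $W$ by the span of the $v_e$ with $e$ of length at most $k$, and $\bar v_e$ the image of $v_e$ in $W'$. The vectors realize $\overline{\Delta}_k(n)$ as a complete fan if $\dim W'=k(n-2k-1)$ and the cones $\operatorname{cone}(\bar v_e:e\in F)$, $F\in\overline{\Delta}_k(n)$, form a complete simplicial fan in $W'$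 (for each face $F$ the vectors $\{\bar v_e\}_{e\in F}$ are linearly independent; cones of faces $F,G$ intersect exactly in the cone of $F\cap G$; the cones cover $W'$). *)

theory Defs
  imports "HOL-Analysis.Analysis"
begin

section \<open>The multiassociahedron complex\<close>

definition edges :: "nat \<Rightarrow> nat set set" where
  "edges n = {e. e \<subseteq> {1..n} \<and> card e = 2}"

definition crossing :: "nat set \<Rightarrow> nat set \<Rightarrow> bool" where
  "crossing e f \<longleftrightarrow> e \<inter> f = {} \<and>
     (\<exists>i j a b. i < j \<and> a < b \<and> e = {i, j} \<and> f = {a, b} \<and>
        (i < a \<and> a < j \<and> j < b \<or> a < i \<and> i < b \<and> b < j))"

definition edge_length :: "nat \<Rightarrow> nat set \<Rightarrow> nat" where
  "edge_length n e = min (Max e - Min e) (n - (Max e - Min e))"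

definition multiassociahedron :: "nat \<Rightarrow> nat \<Rightarrow> nat set set set" where
  "multiassociahedron k n =
     {F. F \<subseteq> {e \<in> edges n. k + 1 \<le> edge_length n e} \<and>
         \<not> (\<exists>S \<subseteq> F. card S = k + 1 \<and> pairwise crossing S)}"

section \<open>Points in convex position and the cofactor matrix\<close>

text \<open>The points are the distinct vertices of the polygon \<open>convex hull (q ` {1..n})\<close>, and
  cyclically consecutive points span its edges. Both orientations are allowed.\<close>

definition convex_position :: "nat \<Rightarrow> (nat \<Rightarrow> real^2) \<Rightarrow> bool" where
  "convex_position n q \<longleftrightarrow>
     inj_on q {1..n} \<and>
     {x. x extreme_point_of (convex hull (q ` {1..n}))} = q ` {1..n} \<and>
     (\<forall>i\<in>{1..n}. closed_segment (q i) (q (i mod n + 1)) edge_of (convex hull (q ` {1..n})))"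

text \<open>Zero-based position of an index in its finite ordered index type.\<close>

definition position :: "'a::{finite, linorder} \<Rightarrow> nat" where
  "position a = card {..<a}"

definition cofactor_vector :: "real^2 \<Rightarrow> real^2 \<Rightarrow> real^('d::{finite, linorder})" where
  "cofactor_vector p p' =
     (\<chi> t. (p $ 2 - p' $ 2) ^ position t * (p $ 1 - p' $ 1) ^ (CARD('d) - 1 - position t))"

text \<open>The row indexed by the edge \<open>e\<close>. The index type \<open>'d\<close> has \<open>d\<close> elements and \<open>'n\<close> has \<open>n\<close>
  elements; the block of vertex \<open>i \<in> {1..n}\<close> is the \<open>i\<close>-th index of \<open>'n\<close>.\<close>

definition cofactor_row ::
    "(nat \<Rightarrow> real^2) \<Rightarrow> nat set \<Rightarrow> real^('d::{finite, linorder})^('n::{finite, linorder})" where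
  "cofactor_row q e =
     (let i = Min e; j = Max e; c = cofactor_vector (q i) (q j)
      in \<chi> b. if position b + 1 = i then c else if position b + 1 = j then - c else 0)"

section \<open>Realization as a complete fan\<close>

text \<open>\<open>\<pi>\<close>, restricted to the subspace \<open>W\<close>, is a linear map with kernel \<open>U\<close>, so that \<open>\<pi> ` W\<close>
  together with \<open>\<pi>\<close> is the quotient of \<open>W\<close> by \<open>U\<close> with its projection. Taking \<open>\<pi>\<close> to be defined on
  the whole ambient space with values in it is no restriction up to linear isomorphism.\<close>

definition quotient_map :: "'v::real_vector set \<Rightarrow> 'v set \<Rightarrow> ('v \<Rightarrow> 'v) \<Rightarrow> bool" where
  "quotient_map W U \<pi> \<longleftrightarrow> linear \<pi> \<and> {w \<in> W. \<pi> w = 0} = U"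

lemma quotient_map_exists:
  fixes W U :: "'v::real_vector set"
  assumes "subspace U" "U \<subseteq> W"
  shows "\<exists>\<pi>. quotient_map W U \<pi>"
proof -
  obtain p where p: "linear p" "p ` UNIV \<subseteq> U" "\<forall>v\<in>U. p v = v"
    using linear_exists_left_inverse_on[of "\<lambda>x. x" U] assms(1)
    by (auto simp: linear_ident)
  have "linear (\<lambda>x. x - p x)"
    using p(1) by (intro linear_compose_sub linear_ident)
  moreover have "{w \<in> W. w - p w = 0} = U"
    using p(2,3) assms(2) by (auto simp: image_subset_iff) metis
  ultimately show ?thesis unfolding quotient_map_def by blast
qed

text \<open>\<open>\<Delta>\<close> is the set of faces and \<open>v e\<close> the ray generator of the vertex \<open>e\<close>. Injectivity on faces
  makes the independence condition one about the family \<open>v\<close> and not just its set of values.\<close>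

definition complete_simplicial_fan :: "'e set set \<Rightarrow> ('e \<Rightarrow> 'v) \<Rightarrow> 'v::real_vector set \<Rightarrow> bool" where
  "complete_simplicial_fan \<Delta> v W \<longleftrightarrow>
     (\<forall>F\<in>\<Delta>. inj_on v F \<and> independent (v ` F)) \<and>
     (\<forall>F\<in>\<Delta>. \<forall>G\<in>\<Delta>. convex_cone hull (v ` F) \<inter> convex_cone hull (v ` G)
                      = convex_cone hull (v ` (F \<inter> G))) \<and>
     (\<Union>F\<in>\<Delta>. convex_cone hull (v ` F)) = W"

text \<open>All quotients of \<open>W\<close> by \<open>U\<close> are canonically isomorphic, so the condition does not depend on
  \<open>\<pi>\<close>; it is not vacuous by \<open>quotient_map_exists\<close>.\<close>

definition realizes_as_complete_fan ::
    "nat \<Rightarrow> nat \<Rightarrow> (nat set \<Rightarrow> 'v::real_vector) \<Rightarrow> bool" where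
  "realizes_as_complete_fan k n v \<longleftrightarrow>
     (let W = span (v ` edges n);
          U = span (v ` {e \<in> edges n. edge_length n e \<le> k})
      in \<forall>\<pi>. quotient_map W U \<pi> \<longrightarrow>
           dim (\<pi> ` W) = k * (n - 2 * k - 1) \<and>
           complete_simplicial_fan (multiassociahedron k n) (\<pi> \<circ> v) (\<pi> ` W))"

end

theory Submission
  imports Defs
begin

text \<open>
  Write \<open>[a b c]\<close> for the orientation determinant of three points and call an edge long if its length
  is \<open>3\<close>. The seven long edges \<open>{u, u+3}\<close>, \<open>u\<close> in \<open>\<int>/7\<close>, are the vertices of the complex, and three of
  them cross pairwise exactly if they are consecutive. So a face is a set without three consecutive
  elements.

  The proof works with linear relations instead of with the rows themselves. For every
  \<open>X\<close> in \<open>\<real>\<^sup>3\<close>, read as a point in homogeneous coordinates, the numbers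
  \<open>[q\<^sub>i q\<^sub>j X] / \<Prod>\<^sub>l [q\<^sub>i q\<^sub>j q\<^sub>l]\<close>, with \<open>l\<close> ranging over the five other vertices, are the coefficients of
  a relation between the rows. At each vertex this is the vanishing of a divided difference
  (\<open>divided_difference_eq_0\<close>, \<open>stress_equilibrium\<close>). There are no other relations, because one
  that vanishes on a triangle vanishes everywhere (\<open>equilibrium_imp_stress\<close>). On the long edges,
  directed from \<open>u\<close> to \<open>u+3\<close>, the denominators all have the sign of the orientation of the heptagon.
  Hence the relations modulo the short edges are, up to positive weights, the simultaneous values at
  \<open>X\<close> of the seven line forms \<open>[u, u+3, X]\<close>. They form a space of dimension \<open>3\<close>, so the quotient has
  dimension \<open>7 - 3 = 4\<close>.

  To have a complete fan means that every vector of seven coefficients is congruent, modulo these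
  values, to exactly one nonnegative vector supported on a face (\<open>complete_simplicial_fanI\<close>). The
  third coordinate of \<open>X\<close> selects it. For the complement of a facet the three diagonals bound a
  triangle lying to the left of each of them, which makes the third coordinate a positive combination of
  their line forms (\<open>facet_relation\<close>). A nonnegative representative supported on a facet therefore
  minimises the third coordinate, and is the only one that does (\<open>nonneg_rep_unique\<close>). Conversely, a
  minimiser is supported on a face, since three positive consecutive coefficients
  leave room to move away from a vertex of the heptagon and decrease the coordinate
  (\<open>nonneg_rep_exists\<close>). That there are nonnegative representatives at all is the existence of a
  point strictly to the left of all seven diagonals (\<open>exists_left_of_all\<close>).
\<close>

section \<open>Orientation of points in convex position\<close>

definition cross2 :: "real^2 \<Rightarrow> real^2 \<Rightarrow> real" where
  "cross2 u v = u $ 1 * v $ 2 - u $ 2 * v $ 1"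

definition orient :: "real^2 \<Rightarrow> real^2 \<Rightarrow> real^2 \<Rightarrow> real" where
  "orient a b c = cross2 (b - a) (c - a)"

lemma orient_eq:
  "orient a b c = (b$1 - a$1) * (c$2 - a$2) - (b$2 - a$2) * (c$1 - a$1)"
  by (simp add: orient_def cross2_def)

lemma orient_rotate: "orient b c a = orient a b c"
  by (simp add: orient_eq algebra_simps)

lemma orient_swap: "orient b a c = - orient a b c"
  by (simp add: orient_eq algebra_simps)

lemma orient_same [simp]: "orient a a c = 0" "orient a b a = 0" "orient a b b = 0"
  by (simp_all add: orient_eq)

lemma orient_zero_imp_on_line:
  assumes "orient a b c = 0" "a \<noteq> b"
  obtains t where "c = a + t *\<^sub>R (b - a)"
proof (cases "b$1 = a$1")
  case False
  define t where "t = (c$1 - a$1) / (b$1 - a$1)"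
  have t: "t * (b$1 - a$1) = c$1 - a$1" using False by (simp add: t_def)
  have "(b$1 - a$1) * (c$2 - a$2 - t * (b$2 - a$2)) = 0"
    using assms(1) t by (simp add: orient_eq) algebra
  then have "c = a + t *\<^sub>R (b - a)"
    using False t by (simp add: vec_eq_iff forall_2)
  then show ?thesis by (rule that)
next
  case True
  then have ne: "b$2 \<noteq> a$2" using assms(2) by (simp add: vec_eq_iff forall_2)
  then have "c = a + ((c$2 - a$2) / (b$2 - a$2)) *\<^sub>R (b - a)"
    using assms(1) True by (simp add: vec_eq_iff forall_2 orient_eq)
  then show ?thesis by (rule that)
qed

lemma not_extreme_between:
  assumes "b extreme_point_of S" "a \<in> S" "a + t *\<^sub>R (b - a) \<in> S" "a \<noteq> b" "1 < t"
  shows False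
proof -
  have "b = (1 - 1/t) *\<^sub>R a + (1/t) *\<^sub>R (a + t *\<^sub>R (b - a))"
    using assms(5) by (simp add: algebra_simps)
  moreover have "a \<noteq> a + t *\<^sub>R (b - a)" using assms(4,5) by auto
  moreover have "0 < 1/t" "1/t < 1" using assms(5) by auto
  ultimately have "b \<in> open_segment a (a + t *\<^sub>R (b - a))"
    unfolding in_segment by blast
  then show False using assms(1-3) by (auto simp: extreme_point_of_def)
qed

lemma extreme_points_not_collinear:
  assumes "a extreme_point_of S" "b extreme_point_of S" "c extreme_point_of S"
    and "a \<noteq> b" "a \<noteq> c" "b \<noteq> c"
  shows "orient a b c \<noteq> 0"
proof
  assume "orient a b c = 0"
  then obtain t where t: "c = a + t *\<^sub>R (b - a)"
    using orient_zero_imp_on_line assms(4) by blast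
  have mem: "a \<in> S" "b \<in> S" "c \<in> S" using assms(1-3) by (auto simp: extreme_point_of_def)
  have "t \<noteq> 0" "t \<noteq> 1" using t assms(5,6) by auto
  then consider "t > 1" | "t < 0" | "0 < t" "t < 1" by linarith
  then show False
  proof cases
    case 1 then show False
      using not_extreme_between[OF assms(2) mem(1), of t] mem t assms(4) by simp
  next
    case 2
    have "b + (1 - t) *\<^sub>R (a - b) = c" using t by (simp add: algebra_simps)
    then show False
      using not_extreme_between[OF assms(1) mem(2), of "1 - t"] mem assms(4) 2 by simp
  next
    case 3
    have "c = (1 - t) *\<^sub>R a + t *\<^sub>R b" using t by (simp add: algebra_simps)
    then have "c \<in> open_segment a b" unfolding in_segment using 3 assms(4) by blast
    then show False using assms(3) mem by (auto simp: extreme_point_of_def)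
  qed
qed

text \<open>A segment joining two points on different sides of the line through an edge would meet that
  line either inside the edge, which a face forbids, or beyond one of its ends, which then fails to
  be extreme.\<close>

lemma edge_same_side:
  assumes S: "convex S" and face: "closed_segment a b face_of S"
    and ext: "a extreme_point_of S" "b extreme_point_of S"
      "c extreme_point_of S" "d extreme_point_of S"
    and ne: "a \<noteq> b" "c \<noteq> a" "c \<noteq> b" "d \<noteq> a" "d \<noteq> b"
  shows "0 < orient a b c * orient a b d"
proof (rule ccontr)
  assume "\<not> ?thesis"
  moreover have c0: "orient a b c \<noteq> 0" and d0: "orient a b d \<noteq> 0"
    using extreme_points_not_collinear ext ne by metis+
  ultimately have neg: "orient a b c * orient a b d < 0"
    by (metis linorder_neqE_linordered_idom mult_eq_0_iff)
  define u where "u = orient a b c / (orient a b c - orient a b d)"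
  have u: "0 < u" "u < 1" "u * (orient a b c - orient a b d) = orient a b c"
    using neg by (auto simp: u_def field_simps mult_less_0_iff)
  define z where "z = (1 - u) *\<^sub>R c + u *\<^sub>R d"
  have "orient a b z = (1 - u) * orient a b c + u * orient a b d"
    by (simp add: z_def orient_eq algebra_simps)
  also have "\<dots> = 0" using u(3) by (simp add: algebra_simps)
  finally have "orient a b z = 0" .
  then obtain t where t: "z = a + t *\<^sub>R (b - a)"
    using orient_zero_imp_on_line ne(1) by blast
  have mem: "a \<in> S" "b \<in> S" "c \<in> S" "d \<in> S" using ext by (auto simp: extreme_point_of_def)
  have "c \<noteq> d" using neg by auto
  then have z_open: "z \<in> open_segment c d" unfolding in_segment using u z_def by blast
  have zS: "z \<in> S"
    using mem S u by (auto simp: z_def intro!: convexD)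
  consider "t > 1" | "t < 0" | "0 \<le> t" "t \<le> 1" by linarith
  then show False
  proof cases
    case 1 then show False
      using not_extreme_between[OF ext(2) mem(1), of t] zS t ne(1) by simp
  next
    case 2
    have "b + (1 - t) *\<^sub>R (a - b) = z" using t by (simp add: algebra_simps)
    then show False
      using not_extreme_between[OF ext(1) mem(2), of "1 - t"] zS ne(1) 2 by simp
  next
    case 3
    have "z = (1 - t) *\<^sub>R a + t *\<^sub>R b" using t by (simp add: algebra_simps)
    then have "z \<in> closed_segment a b" unfolding in_segment using 3 by blast
    then have "c \<in> closed_segment a b"
      using face mem z_open by (auto simp: face_of_def)
    then obtain r where r: "c = (1 - r) *\<^sub>R a + r *\<^sub>R b" unfolding in_segment by blast
    have "orient a b c = 0" unfolding r by (simp add: orient_eq algebra_simps)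
    then show False using c0 by simp
  qed
qed

text \<open>Indexing the vertices of an \<open>n\<close>-gon periodically by all natural numbers removes the wrap-around
  from cyclic statements: three indices in cyclic order become \<open>i < j < k < i + n\<close>.\<close>

definition cyclic_points :: "nat \<Rightarrow> (nat \<Rightarrow> 'a) \<Rightarrow> nat \<Rightarrow> 'a" where
  "cyclic_points n q u = q (u mod n + 1)"

lemma cyclic_points_add [simp]: "cyclic_points n q (u + n) = cyclic_points n q u"
  by (simp add: cyclic_points_def)

text \<open>Seen from \<open>Q i\<close>, all other points lie in the half plane bounded by the line through the first
  edge, so the angular order in which they are met is a linear order, and the relation
  \<open>0 < orient (Q i) (Q j) (Q k)\<close> is transitive by a three-term Pluecker identity. Hence positivity
  for consecutive \<open>j\<close>, \<open>k\<close> propagates.\<close>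

lemma locally_convex_imp_cyclic:
  fixes Q :: "nat \<Rightarrow> real^2"
  assumes per: "\<And>i. Q (i + n) = Q i" and n: "3 \<le> n"
    and left: "\<And>i k. i + 1 < k \<Longrightarrow> k < i + n \<Longrightarrow> 0 < s * orient (Q i) (Q (i+1)) (Q k)"
    and "i < j" "j < k" "k < i + n"
  shows "0 < s * orient (Q i) (Q j) (Q k)"
proof -
  have "j < k \<Longrightarrow> k < i + n \<Longrightarrow> 0 < s * orient (Q i) (Q j) (Q k)"
  proof (induction k)
    case (Suc k)
    have step: "0 < s * orient (Q i) (Q k) (Q (Suc k))" if "i < k"
    proof -
      have "0 < s * orient (Q k) (Q (k+1)) (Q (i + n))"
        by (rule left) (use Suc.prems that in auto)
      then show ?thesis by (simp add: per orient_rotate)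
    qed
    show ?case
    proof (cases "j = k \<or> j = i + 1")
      case True
      then show ?thesis using step left Suc.prems assms(4) by auto
    next
      case False
      let ?e = "Q (i+1)"
      let ?O = "\<lambda>x y. s * orient (Q i) x y"
      have IH: "0 < ?O (Q j) (Q k)" using Suc False by auto
      have st: "0 < ?O (Q k) (Q (Suc k))" using step assms(4) Suc.prems by auto
      have e: "0 < ?O ?e (Q j)" "0 < ?O ?e (Q k)" "0 < ?O ?e (Q (Suc k))"
        using False Suc.prems assms(4) left[of i j] left[of i k] left[of i "Suc k"] by simp_all
      have "?O ?e (Q k) * ?O (Q j) (Q (Suc k))
          = ?O ?e (Q j) * ?O (Q k) (Q (Suc k)) + ?O ?e (Q (Suc k)) * ?O (Q j) (Q k)"
        unfolding orient_eq by algebra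
      also have "\<dots> > 0" using mult_pos_pos[OF e(1) st] mult_pos_pos[OF e(3) IH] by linarith
      finally show ?thesis using e(2) by (rule zero_less_mult_pos)
    qed
  qed simp
  then show ?thesis using assms by blast
qed

lemma convex_position_orient:
  assumes conv: "convex_position n q" and n: "3 \<le> n"
  obtains s :: real where "s = 1 \<or> s = - 1"
    and "\<And>i j k. i < j \<Longrightarrow> j < k \<Longrightarrow> k < i + n \<Longrightarrow>
      0 < s * orient (cyclic_points n q i) (cyclic_points n q j) (cyclic_points n q k)"
proof -
  define Q where "Q = cyclic_points n q"
  define S where "S = convex hull (q ` {1..n})"
  have inj: "inj_on q {1..n}"
    and extS: "{x. x extreme_point_of S} = q ` {1..n}"
    and edge: "\<And>i. i\<in>{1..n} \<Longrightarrow> closed_segment (q i) (q (i mod n + 1)) edge_of S"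
    using conv unfolding convex_position_def S_def by blast+
  have "convex S" by (simp add: S_def)
  have per: "Q (i + n) = Q i" for i by (simp add: Q_def)
  have ext: "Q i extreme_point_of S" for i
  proof -
    have "i mod n < n" using n by simp
    then have "Q i \<in> q ` {1..n}" by (auto simp: Q_def cyclic_points_def)
    then show ?thesis using extS by blast
  qed
  have neq: "Q i \<noteq> Q j" if "i < j" "j < i + n" for i j
  proof
    assume "Q i = Q j"
    then have "i mod n + 1 = j mod n + 1"
      using n by (intro inj_onD[OF inj]) (auto simp: Q_def cyclic_points_def Suc_le_eq)
    then have "n dvd j - i" using that mod_eq_dvd_iff_nat[of i j n] by simp
    then show False using that by (auto dest: dvd_imp_le)
  qed
  have face: "closed_segment (Q i) (Q (i+1)) face_of S" for i
  proof -
    have "closed_segment (q (i mod n + 1)) (q ((i mod n + 1) mod n + 1)) edge_of S"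
      by (rule edge) (use n in \<open>simp add: Suc_leI\<close>)
    then show ?thesis by (simp add: Q_def cyclic_points_def mod_Suc_eq edge_of_def)
  qed
  have same: "0 < orient (Q i) (Q (i+1)) (Q k) * orient (Q i) (Q (i+1)) (Q l)"
    if "i + 1 < k" "k < i + n" "i + 1 < l" "l < i + n" for i k l
    by (rule edge_same_side[OF \<open>convex S\<close> face ext ext ext ext])
      (use that neq[of i "i+1"] neq[of i k] neq[of "i+1" k] neq[of i l] neq[of "i+1" l]
        in \<open>auto simp: eq_commute\<close>)
  define s where "s = sgn (orient (Q 0) (Q 1) (Q 2))"
  \<comment> \<open>Consecutive edges share the triangle \<open>Q i\<close>, \<open>Q (i+1)\<close>, \<open>Q (i+2)\<close>, so they have their polygon on
    the same side.\<close>
  have tri: "0 < s * orient (Q i) (Q (i+1)) (Q (i+2))" for i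
  proof (induction i)
    case 0
    have "orient (Q 0) (Q 1) (Q 2) \<noteq> 0" 
      using extreme_points_not_collinear[OF ext ext ext neq neq neq, of 0 1 2] n by simp
    then show ?case by (simp add: s_def sgn_if numeral_2_eq_2)
  next
    case (Suc i)
    have 1: "0 < s * orient (Q (i+1)) (Q (i+2)) (Q (i + n))"
      using Suc by (simp add: per orient_rotate)
    have "0 < orient (Q (i+1)) (Q (i+1+1)) (Q (i + n)) * orient (Q (i+1)) (Q (i+1+1)) (Q (i+3))"
    proof (cases "n = 3")
      case True
      have "orient (Q (i+1)) (Q (i+2)) (Q (i + n)) \<noteq> 0" using 1 by auto
      then show ?thesis using True by (simp add: zero_less_mult_iff) linarith
    next
      case False
      then show ?thesis using n by (intro same) auto
    qed
    then have "0 < (s * orient (Q (i+1)) (Q (i+2)) (Q (i + n))) * (s * orient (Q (i+1)) (Q (i+2)) (Q (i+3)))"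
      using 1 by (simp add: zero_less_mult_iff) (smt (verit))
    then have "0 < s * orient (Q (i+1)) (Q (i+2)) (Q (i+3))"
      using 1 by (rule zero_less_mult_pos)
    then show ?case by (simp add: numeral_3_eq_3)
  qed
  have left: "0 < s * orient (Q i) (Q (i+1)) (Q k)" if "i + 1 < k" "k < i + n" for i k
    using same[of i "i+2" k] tri[of i] that by (auto simp: zero_less_mult_iff)
  have "s = 1 \<or> s = - 1" using tri[of 0] by (auto simp: s_def sgn_if)
  then show ?thesis
    using that locally_convex_imp_cyclic[of Q n s, OF per n left] unfolding Q_def by blast
qed

section \<open>The long diagonals of a convex heptagon\<close>

definition line_form :: "real^2 \<Rightarrow> real^2 \<Rightarrow> (real^2) \<times> real \<Rightarrow> real" where
  "line_form a b X = cross2 (b - a) (fst X - snd X *\<^sub>R a)"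

lemma line_form_eq:
  "line_form a b X = (b$1 - a$1) * (fst X $ 2 - snd X * a$2) - (b$2 - a$2) * (fst X $ 1 - snd X * a$1)"
  by (simp add: line_form_def cross2_def)

lemma line_form_point: "line_form a b (c, 1) = orient a b c"
  by (simp add: line_form_def orient_def)

lemma line_form_add: "line_form a b (X + Y) = line_form a b X + line_form a b Y"
  by (simp add: line_form_eq algebra_simps)

lemma line_form_diff: "line_form a b (X - Y) = line_form a b X - line_form a b Y"
  by (simp add: line_form_eq algebra_simps)

lemma line_form_scaleR: "line_form a b (r *\<^sub>R X) = r * line_form a b X"
  by (simp add: line_form_eq algebra_simps)

lemma line_form_sum: "line_form a b (\<Sum>i\<in>I. X i) = (\<Sum>i\<in>I. line_form a b (X i))"
proof (cases "finite I")
  case True then show ?thesis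
    by (induction rule: finite_induct) (simp_all add: line_form_add, simp add: line_form_eq)
qed (simp add: line_form_eq)

text \<open>Three directions in the plane satisfy one linear relation; applied to the three line forms it
  kills the dependence on \<open>fst X\<close>. The constant is found by evaluating at the common point \<open>a\<close>.\<close>

lemma three_lines_relation:
  "cross2 (e - b) (a - d) * line_form a c X + cross2 (a - d) (c - a) * line_form b e X
     + cross2 (c - a) (e - b) * line_form d a X
   = cross2 (a - d) (c - a) * orient b e a * snd X"
  unfolding line_form_eq orient_eq cross2_def vector_minus_component by algebra

text \<open>The two points evaluated next are the intersections of the lines \<open>p0 p3\<close>, \<open>p2 p5\<close> and of the lines
  \<open>p1 p4\<close>, \<open>p2 p5\<close>, scaled to be polynomial in the \<open>p\<close>s. Whenever a line meets one of the two lines in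
  a vertex, a three-term Pluecker relation turns the value into a product. The remaining
  values are determinants of three consecutive diagonals, whose sign is not determined by convexity.\<close>

lemma diagonal_intersection_values:
  fixes p0 p1 p2 p3 p4 p5 p6 :: "real^2"
  defines "Y \<equiv> orient p0 p3 p5 *\<^sub>R (p2, 1) + orient p0 p2 p3 *\<^sub>R (p5, 1)"
  shows "line_form p0 p3 Y = 0"
    and "line_form p1 p4 Y = orient p1 p4 p5 * orient p0 p2 p3 - orient p1 p2 p4 * orient p0 p3 p5"
    and "line_form p2 p5 Y = 0"
    and "line_form p3 p6 Y = orient p0 p3 p6 * orient p2 p3 p5"
    and "line_form p4 p0 Y = orient p0 p2 p5 * orient p0 p3 p4"
    and "line_form p5 p1 Y = orient p1 p2 p5 * orient p0 p3 p5"
    and "line_form p6 p2 Y = orient p2 p5 p6 * orient p0 p2 p3"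
  unfolding Y_def line_form_add line_form_scaleR line_form_point orient_eq
  by (simp_all add: algebra_simps)

lemma adjacent_diagonal_intersection_values:
  fixes p0 p1 p2 p3 p4 p5 p6 :: "real^2"
  defines "Y \<equiv> orient p1 p4 p5 *\<^sub>R (p2, 1) + orient p1 p2 p4 *\<^sub>R (p5, 1)"
  shows "line_form p0 p3 Y = orient p1 p2 p4 * orient p0 p3 p5 - orient p1 p4 p5 * orient p0 p2 p3"
    and "line_form p1 p4 Y = 0"
    and "line_form p2 p5 Y = 0"
    and "line_form p3 p6 Y = orient p2 p3 p5 * orient p1 p4 p6 - orient p2 p5 p6 * orient p1 p3 p4"
    and "line_form p4 p0 Y = orient p0 p1 p4 * orient p2 p4 p5"
    and "line_form p5 p1 Y = orient p1 p2 p5 * orient p1 p4 p5"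
    and "line_form p6 p2 Y = orient p2 p5 p6 * orient p1 p2 p4"
  unfolding Y_def line_form_add line_form_scaleR line_form_point orient_eq
  by (simp_all add: algebra_simps)

lemma cross2_eq_0_both:
  assumes "cross2 u p = 0" "cross2 v p = 0" "cross2 u v \<noteq> 0"
  shows "p = 0"
proof -
  have "cross2 u v * p$1 = 0" "cross2 u v * p$2 = 0"
    using assms(1,2) unfolding cross2_def by algebra+
  then show ?thesis using assms(3) by (simp add: vec_eq_iff forall_2)
qed

lemma periodic_window:
  fixes f :: "nat \<Rightarrow> 'a"
  assumes per: "\<And>i. f (i + 7) = f i" and win: "\<And>i. i < 7 \<Longrightarrow> P (f (u + i))"
  shows "P (f n)"
proof -
  have step: "f (i + 7 * k) = f i" for i k
  proof (induction k)
    case (Suc k)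
    have "f (i + 7 * Suc k) = f ((i + 7 * k) + 7)" by (simp add: algebra_simps)
    then show ?case using per Suc by simp
  qed simp
  have red: "f i = f (i mod 7)" for i
    using step[of "i mod 7" "i div 7"] by simp
  define i where "i = (n + 6 * u) mod 7"
  have "(u + i) mod 7 = (u + (n + 6 * u)) mod 7" unfolding i_def by (rule mod_add_right_eq)
  also have "u + (n + 6 * u) = n + 7 * u" by simp
  also have "(n + 7 * u) mod 7 = n mod 7" by simp
  finally have "f (u + i) = f n" using red by metis
  moreover have "i < 7" by (simp add: i_def)
  ultimately show ?thesis using win by metis
qed

lemma less_7_cases: "(i::nat) < 7 \<Longrightarrow> i = 0 \<or> i = 1 \<or> i = 2 \<or> i = 3 \<or> i = 4 \<or> i = 5 \<or> i = 6"
  by auto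

text \<open>The facets of the complex on \<open>\<int>/7\<close> whose minimal nonfaces are the sets of three consecutive
  elements are the complements of the sets \<open>{u, u+1, u+4}\<close> and \<open>{u, u+2, u+4}\<close>. In terms of the
  complement \<open>Z\<close> of a face this says that \<open>Z\<close> contains one of them.\<close>

lemma complement_of_face:
  assumes per: "\<And>i. Z (i + 7) = Z i" and face: "\<And>i::nat. Z i \<or> Z (i+1) \<or> Z (i+2)"
  obtains u v where "u < 7" "Z u" "Z v" "Z (u+4)" "v = u + 1 \<or> v = u + 2"
proof -
  have p: "Z 7 = Z 0" "Z 8 = Z 1" "Z 9 = Z 2" "Z 10 = Z 3"
    using per[of 0] per[of 1] per[of 2] per[of 3] by simp_all
  have f: "Z 0 \<or> Z 1 \<or> Z 2" "Z 1 \<or> Z 2 \<or> Z 3" "Z 2 \<or> Z 3 \<or> Z 4" "Z 3 \<or> Z 4 \<or> Z 5"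
    "Z 4 \<or> Z 5 \<or> Z 6" "Z 5 \<or> Z 6 \<or> Z 0" "Z 6 \<or> Z 0 \<or> Z 1"
    using face[of 0] face[of 1] face[of 2] face[of 3] face[of 4] face[of 5] face[of 6]
    by (simp_all add: p numeral_2_eq_2[symmetric] del: One_nat_def)
  have bool: "(a \<and> e \<and> (b \<or> c)) \<or> (b \<and> f \<and> (c \<or> d)) \<or> (c \<and> g \<and> (d \<or> e)) \<or> (d \<and> a \<and> (e \<or> f))
      \<or> (e \<and> b \<and> (f \<or> g)) \<or> (f \<and> c \<and> (g \<or> a)) \<or> (g \<and> d \<and> (a \<or> b))"
    if "a \<or> b \<or> c" "b \<or> c \<or> d" "c \<or> d \<or> e" "d \<or> e \<or> f" "e \<or> f \<or> g" "f \<or> g \<or> a" "g \<or> a \<or> b"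
    for a b c d e f g
    using that by (cases a; cases b; cases c; cases d; cases e; cases f; cases g; simp)
  have ex: thesis if "u < 7" "Z u \<and> Z (u+4) \<and> (Z (u+1) \<or> Z (u+2))" for u
    using that \<open>\<And>v u. u < 7 \<Longrightarrow> Z u \<Longrightarrow> Z v \<Longrightarrow> Z (u+4) \<Longrightarrow> v = u + 1 \<or> v = u + 2 \<Longrightarrow> thesis\<close> by blast
  show thesis
    using bool[OF f] ex[of 0] ex[of 1] ex[of 2] ex[of 3] ex[of 4] ex[of 5] ex[of 6]
    unfolding p by (elim disjE; simp add: p numeral_2_eq_2[symmetric] numeral_3_eq_3[symmetric] del: One_nat_def)
qed

locale convex_heptagon =
  fixes Q :: "nat \<Rightarrow> real^2"
  assumes periodic: "Q (i + 7) = Q i"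
    and positive: "i < j \<Longrightarrow> j < k \<Longrightarrow> k < i + 7 \<Longrightarrow> 0 < orient (Q i) (Q j) (Q k)"
begin

abbreviation tri :: "nat \<Rightarrow> nat \<Rightarrow> nat \<Rightarrow> real" where
  "tri i j k \<equiv> orient (Q i) (Q j) (Q k)"

definition diag :: "nat \<Rightarrow> (real^2) \<times> real \<Rightarrow> real" where
  "diag u X = line_form (Q u) (Q (u + 3)) X"

lemma diag_periodic [simp]: "diag (u + 7) X = diag u X"
proof -
  have "u + 7 + 3 = (u + 3) + 7" by simp
  then show ?thesis by (simp only: diag_def periodic)
qed

lemma diag_shift:
  "diag (u+1) X = line_form (Q (u+1)) (Q (u+4)) X"
  "diag (u+2) X = line_form (Q (u+2)) (Q (u+5)) X"
  "diag (u+3) X = line_form (Q (u+3)) (Q (u+6)) X"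
  "diag (u+4) X = line_form (Q (u+4)) (Q u) X"
  "diag (u+5) X = line_form (Q (u+5)) (Q (u+1)) X"
  "diag (u+6) X = line_form (Q (u+6)) (Q (u+2)) X"
proof -
  have e: "u+1+3 = u+4" "u+2+3 = u+5" "u+3+3 = u+6" "u+4+3 = u+7" "u+5+3 = (u+1)+7" "u+6+3 = (u+2)+7"
    by simp_all
  show "diag (u+1) X = line_form (Q (u+1)) (Q (u+4)) X"
    "diag (u+2) X = line_form (Q (u+2)) (Q (u+5)) X"
    "diag (u+3) X = line_form (Q (u+3)) (Q (u+6)) X"
    "diag (u+4) X = line_form (Q (u+4)) (Q u) X"
    "diag (u+5) X = line_form (Q (u+5)) (Q (u+1)) X"
    "diag (u+6) X = line_form (Q (u+6)) (Q (u+2)) X"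
    unfolding diag_def e periodic by (rule refl)+
qed

lemmas diag_simps = diag_def line_form_add line_form_diff line_form_scaleR line_form_sum

text \<open>The three oriented diagonals indexed by the complement of a facet bound a triangle that lies to
  the left of each of them. Equivalently, the form \<open>snd\<close> is in the open cone of their forms.\<close>

lemma facet_relation:
  assumes "v = u + 1 \<or> v = u + 2"
  obtains \<alpha> \<beta> \<gamma> \<kappa> where "0 < \<alpha>" "0 < \<beta>" "0 < \<gamma>" "0 < \<kappa>"
    "\<And>X. \<alpha> * diag u X + \<beta> * diag v X + \<gamma> * diag (u+4) X = \<kappa> * snd X"
proof -
  let ?a = "Q u" and ?c = "Q (u+3)" and ?b = "Q v" and ?e = "Q (v+3)" and ?d = "Q (u+4)"
  let ?\<alpha> = "cross2 (?e - ?b) (?a - ?d)" and ?\<beta> = "cross2 (?a - ?d) (?c - ?a)"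
    and ?\<gamma> = "cross2 (?c - ?a) (?e - ?b)"
  have "?\<beta> = tri u (u+3) (u+4)"
    by (simp add: orient_eq cross2_def algebra_simps)
  then have \<beta>: "0 < ?\<beta>" by (simp add: positive)
  have "0 < ?\<alpha> \<and> 0 < ?\<gamma> \<and> 0 < orient ?b ?e ?a"
    using assms
  proof
    assume v: "v = u + 1"
    have e: "v + 3 = u + 4" using v by simp
    have "?\<alpha> = tri u (u+1) (u+4)" "orient ?b ?e ?a = tri u (u+1) (u+4)"
      "?\<gamma> = tri u (u+3) (u+4) + tri u (u+1) (u+3)"
      unfolding e unfolding v by (simp_all add: orient_eq cross2_def algebra_simps)
    then show ?thesis by (simp add: positive add_pos_pos)
  next
    assume v: "v = u + 2"
    have e: "v + 3 = u + 5" using v by simp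
    have "?\<alpha> = tri u (u+2) (u+5) + tri (u+2) (u+4) (u+5)" "orient ?b ?e ?a = tri u (u+2) (u+5)"
      "?\<gamma> = tri u (u+3) (u+5) + tri u (u+2) (u+3)"
      unfolding e unfolding v by (simp_all add: orient_eq cross2_def algebra_simps)
    then show ?thesis by (simp add: positive add_pos_pos)
  qed
  then have "0 < ?\<alpha>" "0 < ?\<gamma>" "0 < ?\<beta> * orient ?b ?e ?a" using \<beta> by simp_all
  moreover have "?\<alpha> * diag u X + ?\<beta> * diag v X + ?\<gamma> * diag (u+4) X = ?\<beta> * orient ?b ?e ?a * snd X" for X
    using three_lines_relation[of ?e ?b ?a ?d ?c X] by (simp only: diag_shift(4)) (simp only: diag_def)
  ultimately show ?thesis using \<beta> that by blast
qed

lemma diag_injective: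
  assumes "diag u X = 0" "diag (u+4) X = 0" "snd X = 0"
  shows "X = 0"
proof -
  have "cross2 (Q (u+3) - Q u) (fst X) = 0"
    using assms by (simp add: diag_def line_form_def)
  moreover have "cross2 (Q u - Q (u+4)) (fst X) = 0"
    using assms(2,3) unfolding diag_shift by (simp add: line_form_def)
  moreover have "cross2 (Q (u+3) - Q u) (Q u - Q (u+4)) = - tri u (u+3) (u+4)"
    by (simp add: orient_eq cross2_def algebra_simps)
  moreover have "0 < tri u (u+3) (u+4)" by (simp add: positive)
  ultimately have "fst X = 0"
    using cross2_eq_0_both[of "Q (u+3) - Q u" "fst X" "Q u - Q (u+4)"] by linarith
  then show ?thesis using assms(3) by (simp add: prod_eq_iff)
qed

text \<open>The zero set of \<open>c\<close> contains the complement of a facet. Its facet relation shows that a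
  nonnegative \<open>c'\<close>, obtained by moving along \<open>X\<close>, has \<open>0 \<le> snd X\<close>. By symmetry \<open>snd X = 0\<close>, and
  then all terms of the facet relation vanish. Two of the three diagonals meet in a vertex and are not
  parallel, so \<open>X = 0\<close>.\<close>

lemma nonneg_rep_unique:
  assumes per: "\<And>i. c (i + 7) = c i" "\<And>i. c' (i + 7) = c' i"
    and nonneg: "\<And>i. 0 \<le> c i" "\<And>i. 0 \<le> c' i"
    and face: "\<And>i. c i = 0 \<or> c (i+1) = 0 \<or> c (i+2) = 0"
      "\<And>i. c' i = 0 \<or> c' (i+1) = 0 \<or> c' (i+2) = (0::real)"
    and eq: "\<And>i. c' i = c i + diag i X"
  shows "X = 0"
proof -
  have *: "0 \<le> snd Y \<and> (snd Y = 0 \<longrightarrow> Y = 0)"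
    if per: "\<And>i. c (i + 7) = c i"
      and nonneg: "\<And>i. 0 \<le> c' i"
      and face: "\<And>i. c i = 0 \<or> c (i+1) = 0 \<or> c (i+2) = 0"
      and eq: "\<And>i. c' i = c i + diag i Y"
    for c c' :: "nat \<Rightarrow> real" and Y
  proof -
    obtain u v where z: "c u = 0" "c v = 0" "c (u+4) = 0" and v: "v = u + 1 \<or> v = u + 2"
      using complement_of_face[of "\<lambda>i. c i = 0"] per face by metis
    obtain \<alpha> \<beta> \<gamma> \<kappa> where pos: "0 < \<alpha>" "0 < \<beta>" "0 < \<gamma>" "0 < \<kappa>"
      and rel: "\<And>X. \<alpha> * diag u X + \<beta> * diag v X + \<gamma> * diag (u+4) X = \<kappa> * snd X"
      using facet_relation[OF v] by metis
    have n: "0 \<le> \<alpha> * diag u Y" "0 \<le> \<beta> * diag v Y" "0 \<le> \<gamma> * diag (u+4) Y"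
      using nonneg[of u] nonneg[of v] nonneg[of "u+4"] eq z pos by simp_all
    then have "0 \<le> \<kappa> * snd Y" using rel[of Y] by linarith
    then have "0 \<le> snd Y" using pos(4) by (simp add: zero_le_mult_iff)
    moreover have "Y = 0" if "snd Y = 0"
    proof -
      have "\<alpha> * diag u Y + \<beta> * diag v Y + \<gamma> * diag (u+4) Y = 0" using rel[of Y] that by simp
      then have "\<alpha> * diag u Y = 0" "\<gamma> * diag (u+4) Y = 0" using n by linarith+
      then show ?thesis using diag_injective[of u Y] pos that by simp
    qed
    ultimately show ?thesis by simp
  qed
  have "diag i (- X) = - diag i X" for i by (simp add: diag_def line_form_eq algebra_simps)
  then have eq': "c i = c' i + diag i (- X)" for i using eq[of i] by simp
  have "0 \<le> snd X \<and> (snd X = 0 \<longrightarrow> X = 0)"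
    by (rule *[OF per(1) nonneg(2) face(1) eq])
  moreover have "0 \<le> snd (- X) \<and> (snd (- X) = 0 \<longrightarrow> - X = 0)"
    by (rule *[OF per(2) nonneg(1) face(2) eq'])
  ultimately show ?thesis by simp
qed

lemma all_diagonals_nonneg:
  assumes "0 \<le> diag u Y" "0 \<le> diag (u+1) Y" "0 \<le> diag (u+2) Y" "0 \<le> diag (u+3) Y"
    "0 \<le> diag (u+4) Y" "0 \<le> diag (u+5) Y" "0 \<le> diag (u+6) Y"
  shows "0 \<le> diag n Y"
proof -
  have "0 \<le> diag (u + i) Y" if "i < 7" for i
    using less_7_cases[OF that] assms by auto
  then show ?thesis
    using periodic_window[of "\<lambda>i. diag i Y" "\<lambda>x. 0 \<le> x" u n] by simp
qed

text \<open>The value of the line form of diagonal \<open>u+1\<close> at the intersection of the diagonals \<open>u\<close> and \<open>u+2\<close>.\<close>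

definition middle_form :: "nat \<Rightarrow> real" where
  "middle_form u = tri (u+1) (u+4) (u+5) * tri u (u+2) (u+3) - tri (u+1) (u+2) (u+4) * tri u (u+3) (u+5)"

lemma diagonal_intersection_left:
  assumes "0 \<le> middle_form u"
  obtains Y where "\<And>i. 0 \<le> diag i Y"
    "0 < diag (u+3) Y" "0 < diag (u+4) Y" "0 < diag (u+5) Y" "0 < diag (u+6) Y"
proof -
  define Y where "Y = tri u (u+3) (u+5) *\<^sub>R (Q (u+2), 1 :: real) + tri u (u+2) (u+3) *\<^sub>R (Q (u+5), 1)"
  have "diag u Y = 0" "diag (u+1) Y = middle_form u" "diag (u+2) Y = 0"
    and v: "diag (u+3) Y = tri u (u+3) (u+6) * tri (u+2) (u+3) (u+5)"
      "diag (u+4) Y = tri u (u+2) (u+5) * tri u (u+3) (u+4)"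
      "diag (u+5) Y = tri (u+1) (u+2) (u+5) * tri u (u+3) (u+5)"
      "diag (u+6) Y = tri (u+2) (u+5) (u+6) * tri u (u+2) (u+3)"
    unfolding diag_shift middle_form_def Y_def unfolding diag_def
    by (rule diagonal_intersection_values)+
  then have 0: "0 \<le> diag u Y" "0 \<le> diag (u+1) Y" "0 \<le> diag (u+2) Y" using assms by simp_all
  have 3: "0 < diag (u+3) Y" "0 < diag (u+4) Y" "0 < diag (u+5) Y" "0 < diag (u+6) Y"
    unfolding v by (intro mult_pos_pos positive; simp)+
  show ?thesis
    by (rule that[OF all_diagonals_nonneg[of u] 3]) (use 0 3 in \<open>simp_all only: less_imp_le\<close>)
qed

text \<open>There are three candidates for a point to the left of all diagonals: the intersection of the
  diagonals \<open>u\<close> and \<open>u+2\<close>, the next rotation of it, and the intersection of the diagonals \<open>u+1\<close> and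
  \<open>u+2\<close>. The first is to the left of everything unless it is to the right of diagonal \<open>u+1\<close>, and the
  second unless it is to the right of diagonal \<open>u+2\<close>. If both fail, the two failures say exactly that
  the third candidate is to the left of the diagonals \<open>u\<close> and \<open>u+3\<close>.\<close>

lemma exists_weakly_left:
  "\<exists>Y. (\<forall>i. 0 \<le> diag i Y) \<and> 0 < diag (u+4) Y"
proof -
  have shift: "u+1+1 = u+2" "u+1+2 = u+3" "u+1+3 = u+4" "u+1+4 = u+5" "u+1+5 = u+6" by simp_all
  consider "0 \<le> middle_form u" | "0 \<le> middle_form (u+1)" | "middle_form u < 0" "middle_form (u+1) < 0"
    by linarith
  then show ?thesis
  proof cases
    case 1
    then show ?thesis using diagonal_intersection_left by blast
  next
    case 2
    then show ?thesis using diagonal_intersection_left[of "u+1"] unfolding shift by blast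
  next
    case 3
    define Y where "Y = tri (u+1) (u+4) (u+5) *\<^sub>R (Q (u+2), 1 :: real) + tri (u+1) (u+2) (u+4) *\<^sub>R (Q (u+5), 1)"
    have "diag u Y = - middle_form u" "diag (u+1) Y = 0" "diag (u+2) Y = 0"
      "diag (u+3) Y = - middle_form (u+1)"
      and v: "diag (u+4) Y = tri u (u+1) (u+4) * tri (u+2) (u+4) (u+5)"
        "diag (u+5) Y = tri (u+1) (u+2) (u+5) * tri (u+1) (u+4) (u+5)"
        "diag (u+6) Y = tri (u+2) (u+5) (u+6) * tri (u+1) (u+2) (u+4)"
      unfolding diag_shift middle_form_def shift Y_def minus_diff_eq unfolding diag_def
      by (rule adjacent_diagonal_intersection_values)+
    then have 0: "0 \<le> diag u Y" "0 \<le> diag (u+1) Y" "0 \<le> diag (u+2) Y" "0 \<le> diag (u+3) Y"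
      using 3 by simp_all
    have 4: "0 < diag (u+4) Y" "0 < diag (u+5) Y" "0 < diag (u+6) Y"
      unfolding v by (intro mult_pos_pos positive; simp)+
    have "0 \<le> diag i Y" for i
      by (rule all_diagonals_nonneg[of u]) (use 0 4 in \<open>simp_all only: less_imp_le\<close>)
    then show ?thesis using 4 by blast
  qed
qed

text \<open>The candidates lie on diagonals themselves. Adding one for each rotation gives strict inequalities.\<close>

lemma exists_left_of_all: "\<exists>Y. \<forall>i. 0 < diag i Y"
proof -
  obtain y where y: "\<And>u i. 0 \<le> diag i (y u)" "\<And>u. 0 < diag (u+4) (y u)"
    using exists_weakly_left by metis
  define Y where "Y = (\<Sum>u<7. y u)"
  have "0 < diag (4 + i) Y" if "i < 7" for i
  proof -
    have "diag (4 + i) Y = (\<Sum>u<7. diag (4 + i) (y u))" by (simp add: Y_def diag_simps)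
    also have "0 < \<dots>"
      using that y by (intro sum_pos2[of _ i]) (auto simp: add.commute)
    finally show ?thesis .
  qed
  then have "0 < diag n Y" for n
    using periodic_window[of "\<lambda>i. diag i Y" "\<lambda>x. 0 < x" 4 n] by simp
  then show ?thesis by blast
qed

text \<open>A facet relation has nonnegative terms up to a constant, so a bound on \<open>snd\<close> bounds each of them,
  and two line forms and \<open>snd\<close> are coordinates on the space.\<close>

lemma compact_sublevel:
  assumes per: "\<And>i. b (i + 7) = b i"
  shows "compact {X. (\<forall>i. 0 \<le> b i + diag i X) \<and> snd X \<le> m}" (is "compact ?K")
proof -
  obtain \<alpha> \<beta> \<gamma> \<kappa> where pos: "0 < \<alpha>" "0 < \<beta>" "0 < \<gamma>" "0 < \<kappa>"
    and rel: "\<And>X. \<alpha> * diag 0 X + \<beta> * diag 1 X + \<gamma> * diag 4 X = \<kappa> * snd X"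
    using facet_relation[of 1 0] by (metis add_0)
  define f where "f X = (diag 0 X, diag 4 X, snd X)" for X
  have "linear f"
    by (rule linearI) (simp_all add: f_def diag_simps)
  moreover have "inj f"
    unfolding linear_injective_0[OF \<open>linear f\<close>] using diag_injective[of 0] by (auto simp: f_def zero_prod_def)
  ultimately obtain B where B: "0 < B" "\<And>X. B * norm X \<le> norm (f X)"
    using linear_inj_bounded_below_pos by blast
  define s where "s = \<alpha> * b 0 + \<beta> * b 1 + \<gamma> * b 4"
  define M where "M = \<bar>b 0\<bar> + (s + \<kappa> * m) / \<alpha> + (\<bar>b 4\<bar> + (s + \<kappa> * m) / \<gamma>) + (\<bar>m\<bar> + \<bar>s\<bar> / \<kappa>)"
  have "norm X \<le> M / B" if "X \<in> ?K" for X
  proof -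
    have n: "0 \<le> \<alpha> * (b 0 + diag 0 X)" "0 \<le> \<beta> * (b 1 + diag 1 X)" "0 \<le> \<gamma> * (b 4 + diag 4 X)"
      and nn: "0 \<le> b 0 + diag 0 X" "0 \<le> b 4 + diag 4 X"
      and m: "snd X \<le> m"
      using that pos by auto
    have t: "\<alpha> * (b 0 + diag 0 X) + \<beta> * (b 1 + diag 1 X) + \<gamma> * (b 4 + diag 4 X) = s + \<kappa> * snd X"
      using rel[of X] by (simp add: s_def algebra_simps)
    have "\<kappa> * snd X \<le> \<kappa> * m" using m pos by simp
    then have "\<alpha> * (b 0 + diag 0 X) \<le> s + \<kappa> * m" "\<gamma> * (b 4 + diag 4 X) \<le> s + \<kappa> * m"
      using n t by linarith+
    then have "b 0 + diag 0 X \<le> (s + \<kappa> * m) / \<alpha>" "b 4 + diag 4 X \<le> (s + \<kappa> * m) / \<gamma>"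
      using pos by (simp_all add: field_simps)
    then have 1: "\<bar>diag 0 X\<bar> \<le> \<bar>b 0\<bar> + (s + \<kappa> * m) / \<alpha>" "\<bar>diag 4 X\<bar> \<le> \<bar>b 4\<bar> + (s + \<kappa> * m) / \<gamma>"
      using nn by linarith+
    have "- s \<le> \<kappa> * snd X" using n t by linarith
    then have "- (s / \<kappa>) \<le> snd X" using pos by (simp add: field_simps)
    moreover have "s / \<kappa> \<le> \<bar>s\<bar> / \<kappa>" using pos by (simp add: divide_right_mono)
    moreover have "0 \<le> \<bar>s\<bar> / \<kappa>" using pos by simp
    ultimately have 2: "\<bar>snd X\<bar> \<le> \<bar>m\<bar> + \<bar>s\<bar> / \<kappa>" using m by linarith
    have "norm (f X) \<le> \<bar>diag 0 X\<bar> + (\<bar>diag 4 X\<bar> + \<bar>snd X\<bar>)"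
      unfolding f_def by (metis norm_Pair_le add_left_mono order_trans real_norm_def)
    then have "B * norm X \<le> M" using 1 2 B(2)[of X] by (simp add: M_def)
    then show ?thesis using B(1) by (simp add: field_simps)
  qed
  then have "bounded ?K" unfolding bounded_iff by blast
  moreover have "closed ?K"
    unfolding diag_def line_form_eq
    by (intro closed_Collect_conj closed_Collect_all closed_Collect_le continuous_intros)
  ultimately show ?thesis by (simp add: compact_eq_bounded_closed)
qed

text \<open>The representative is the minimiser of \<open>snd\<close>. If its coefficients at three consecutive diagonals
  were all positive, it could be improved by moving away from the vertex \<open>Q (u+6)\<close>, which lies
  weakly to the right of the other four diagonals.\<close>

lemma nonneg_rep_exists:
  assumes per: "\<And>i. b (i + 7) = b i"
  obtains X where "\<And>i. 0 \<le> b i + diag i X"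
    and "\<And>i. b i + diag i X = 0 \<or> b (i+1) + diag (i+1) X = 0 \<or> b (i+2) + diag (i+2) X = 0"
proof -
  define c where "c i X = b i + diag i X" for i X
  have cper: "c (i + 7) X = c i X" for i X using per by (simp add: c_def)
  obtain Y where Y: "\<And>i. 0 < diag i Y" using exists_left_of_all by blast
  obtain X0 where X0: "\<And>i. 0 \<le> c i X0"
  proof -
    define t where "t = (\<Sum>i<7. \<bar>b i\<bar> / diag i Y)"
    have "0 \<le> c (0 + i) (t *\<^sub>R Y)" if "i < 7" for i
    proof -
      have "\<bar>b i\<bar> / diag i Y \<le> t"
        unfolding t_def using that Y by (intro member_le_sum) (auto simp: less_imp_le)
      then have "\<bar>b i\<bar> \<le> t * diag i Y" using Y[of i] by (simp add: field_simps)
      then show ?thesis by (simp add: c_def diag_simps)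
    qed
    then have "0 \<le> c n (t *\<^sub>R Y)" for n
      using periodic_window[of "\<lambda>i. c i (t *\<^sub>R Y)" "\<lambda>x. 0 \<le> x" 0 n] cper by simp
    then show ?thesis using that by blast
  qed
  define K where "K = {X. (\<forall>i. 0 \<le> c i X) \<and> snd X \<le> snd X0}"
  have "compact K" unfolding K_def c_def by (rule compact_sublevel) (rule per)
  moreover have "X0 \<in> K" using X0 by (simp add: K_def)
  ultimately obtain X where X: "X \<in> K" "\<And>X'. X' \<in> K \<Longrightarrow> snd X \<le> snd X'"
    using continuous_attains_inf[of K snd] continuous_on_snd[OF continuous_on_id] by blast
  have "c u X = 0 \<or> c (u+1) X = 0 \<or> c (u+2) X = 0" for u
  proof (rule ccontr)
    assume "\<not> ?thesis"
    then have pos: "0 < c u X" "0 < c (u+1) X" "0 < c (u+2) X"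
      using X(1) by (auto simp: K_def less_le)
    define P where "P = (Q (u+6), 1::real)"
    define \<epsilon> where "\<epsilon> = Min ((\<lambda>i. c (u+i) X / (1 + \<bar>diag (u+i) P\<bar>)) ` {0,1,2})"
    have \<epsilon>: "0 < \<epsilon>" 
      using pos by (simp add: \<epsilon>_def add_pos_nonneg)
    have le: "\<epsilon> * diag (u+i) P \<le> c (u+i) X" if "i \<in> {0,1,2}" for i
    proof -
      have "\<epsilon> \<le> c (u+i) X / (1 + \<bar>diag (u+i) P\<bar>)"
        unfolding \<epsilon>_def using that by (intro Min_le) auto
      then have "\<epsilon> * (1 + \<bar>diag (u+i) P\<bar>) \<le> c (u+i) X"
        by (simp add: field_simps add_pos_nonneg)
      moreover have "\<epsilon> * diag (u+i) P \<le> \<epsilon> * (1 + \<bar>diag (u+i) P\<bar>)"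
        using \<epsilon> by (intro mult_left_mono) auto
      ultimately show ?thesis by linarith
    qed
    define X' where "X' = X - \<epsilon> *\<^sub>R P"
    have c': "c i X' = c i X - \<epsilon> * diag i P" for i by (simp add: X'_def c_def diag_simps)
    have "diag (u+3) P = 0" "diag (u+6) P = 0"
      "diag (u+4) P = - tri u (u+4) (u+6)" "diag (u+5) P = - tri (u+1) (u+5) (u+6)"
      unfolding P_def diag_shift line_form_point orient_eq by algebra+
    then have right: "diag (u+i) P \<le> 0" if "i \<in> {3,4,5,6}" for i
      using that positive[of u "u+4" "u+6"] positive[of "u+1" "u+5" "u+6"] by auto
    have "0 \<le> c (u + i) X'" if "i < 7" for i
    proof (cases "i \<in> {0,1,2}")
      case True then show ?thesis using le c' by simp
    next
      case False
      then have "\<epsilon> * diag (u+i) P \<le> 0" 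
        using right[of i] less_7_cases[OF that] \<epsilon> by (auto simp: mult_le_0_iff)
      moreover have "0 \<le> c (u+i) X" using X(1) by (simp add: K_def)
      ultimately show ?thesis using c' by simp
    qed
    then have "0 \<le> c n X'" for n
      using periodic_window[of "\<lambda>i. c i X'" "\<lambda>x. 0 \<le> x" u n] cper by simp
    moreover have less: "snd X' < snd X" using \<epsilon> by (simp add: X'_def P_def)
    ultimately have "X' \<in> K" using X(1) by (simp add: K_def)
    then show False using X(2) less by (meson not_less)
  qed
  then show ?thesis using that[of X] X(1) by (simp add: K_def c_def)
qed

end

section \<open>Linear relations between the rows of the cofactor matrix\<close>

lemma bij_betw_position:
  "bij_betw position (UNIV :: 'a::{finite, linorder} set) {..<CARD('a)}"
proof -
  have mono: "position a < position b" if "a < b" for a b :: 'a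
    unfolding position_def using that by (intro psubset_card_mono) auto
  have "inj (position :: 'a \<Rightarrow> nat)"
    by (metis mono injI linorder_neqE nat_neq_iff)
  moreover have "position a < CARD('a)" for a :: 'a
    unfolding position_def by (rule psubset_card_mono) auto
  ultimately show ?thesis
    by (intro bij_betw_imageI card_subset_eq) (auto simp: card_image)
qed

lemma cofactor_vector_commute:
  assumes "even CARD('d)"
  shows "- cofactor_vector p p' = (cofactor_vector p' p :: real^('d::{finite, linorder}))"
proof -
  have "- ((p$2 - p'$2) ^ position t * (p$1 - p'$1) ^ (CARD('d) - 1 - position t))
      = (p'$2 - p$2) ^ position t * (p'$1 - p$1) ^ (CARD('d) - 1 - position t)" for t :: 'd
  proof -
    have "position t < CARD('d)" using bij_betwE[OF bij_betw_position] by blast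
    then have odd: "odd (position t + (CARD('d) - 1 - position t))" using assms by simp
    have "(p'$2 - p$2) ^ position t * (p'$1 - p$1) ^ (CARD('d) - 1 - position t)
      = (- 1) ^ (position t + (CARD('d) - 1 - position t)) 
        * ((p$2 - p'$2) ^ position t * (p$1 - p'$1) ^ (CARD('d) - 1 - position t))"
      using power_minus[of "p$2 - p'$2" "position t"]
        power_minus[of "p$1 - p'$1" "CARD('d) - 1 - position t"]
      by (simp add: power_add)
    then show ?thesis using odd by simp
  qed
  then show ?thesis by (simp add: cofactor_vector_def vec_eq_iff)
qed

lemma edges_containing:
  assumes "i \<in> {1..n}"
  shows "{e \<in> edges n. i \<in> e} = (\<lambda>j. {i, j}) ` ({1..n} - {i})"
proof (intro set_eqI iffI)
  fix e assume e: "e \<in> {e \<in> edges n. i \<in> e}"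
  then obtain x y where "e = {x, y}" "x \<noteq> y" by (auto simp: edges_def card_2_iff)
  then show "e \<in> (\<lambda>j. {i, j}) ` ({1..n} - {i})" using e by (auto simp: edges_def)
next
  fix e assume "e \<in> (\<lambda>j. {i, j}) ` ({1..n} - {i})"
  then show "e \<in> {e \<in> edges n. i \<in> e}" using assms by (auto simp: edges_def)
qed

lemma finite_edges [simp]: "finite (edges n)"
  by (rule finite_subset[of _ "Pow {1..n}"]) (auto simp: edges_def)

text \<open>For even \<open>d\<close> the entries of a row are odd functions of the difference of the two points, so the
  sign of the second block is absorbed by exchanging them, and a relation becomes the same condition
  at every vertex.\<close>

lemma cofactor_row_relation:
  fixes q :: "nat \<Rightarrow> real^2"
  assumes d: "even CARD('d)"
  shows "(\<Sum>e\<in>edges CARD('n). \<omega> e *\<^sub>R (cofactor_row q e :: real^('d::{finite, linorder})^('n::{finite, linorder}))) = 0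
    \<longleftrightarrow> (\<forall>i\<in>{1..CARD('n)}. \<forall>t<CARD('d). (\<Sum>j\<in>{1..CARD('n)} - {i}.
          \<omega> {i, j} * ((q i $ 2 - q j $ 2) ^ t * (q i $ 1 - q j $ 1) ^ (CARD('d) - 1 - t))) = 0)"
    (is "?S = 0 \<longleftrightarrow> ?R")
proof -
  let ?n = "CARD('n)"
  have block: "(\<Sum>e\<in>edges ?n. \<omega> e *\<^sub>R (cofactor_row q e :: ((real, 'd) vec, 'n) vec)) $ b
    = (\<Sum>j\<in>{1..?n} - {position b + 1}. \<omega> {position b + 1, j} *\<^sub>R cofactor_vector (q (position b + 1)) (q j))"
    for b :: 'n
  proof -
    define i where "i = position b + 1"
    have pb: "Suc (position b) = i" by (simp add: i_def)
    have i: "i \<in> {1..?n}"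
      using bij_betwE[OF bij_betw_position[where 'a = 'n]] by (simp add: i_def Suc_le_eq)
    have row: "(cofactor_row q {i, j} :: ((real, 'd) vec, 'n) vec) $ b = cofactor_vector (q i) (q j)" if "i \<noteq> j" for j
      using that cofactor_vector_commute[OF d, of "q j" "q i"]
      by (cases "i < j") (auto simp: cofactor_row_def Let_def pb min_def max_def)
    have zero: "(cofactor_row q e :: ((real, 'd) vec, 'n) vec) $ b = 0" if "e \<in> edges ?n - {e \<in> edges ?n. i \<in> e}" for e
    proof -
      have "e \<noteq> {}" "finite e" using that by (auto simp: edges_def intro: finite_subset)
      then have "Min e \<in> e" "Max e \<in> e" by simp_all
      moreover have "i \<notin> e" using that by simp
      ultimately show ?thesis
        by (auto simp: cofactor_row_def Let_def pb)
    qed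
    have "(\<Sum>e\<in>edges ?n. \<omega> e *\<^sub>R (cofactor_row q e :: ((real, 'd) vec, 'n) vec)) $ b
        = (\<Sum>e\<in>edges ?n. \<omega> e *\<^sub>R ((cofactor_row q e :: ((real, 'd) vec, 'n) vec) $ b))"
      by simp
    also have "\<dots> = (\<Sum>e\<in>{e \<in> edges ?n. i \<in> e}. \<omega> e *\<^sub>R ((cofactor_row q e :: ((real, 'd) vec, 'n) vec) $ b))"
      by (rule sum.mono_neutral_right) (use zero in auto)
    also have "\<dots> = (\<Sum>j\<in>{1..?n} - {i}. \<omega> {i, j} *\<^sub>R ((cofactor_row q {i, j} :: ((real, 'd) vec, 'n) vec) $ b))"
      unfolding edges_containing[OF i]
      by (subst sum.reindex) (auto simp: inj_on_def doubleton_eq_iff)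
    also have "\<dots> = (\<Sum>j\<in>{1..?n} - {i}. \<omega> {i, j} *\<^sub>R cofactor_vector (q i) (q j))"
      by (rule sum.cong) (auto simp: row)
    finally show ?thesis by (simp add: i_def)
  qed
  define f where "f i t = (\<Sum>j\<in>{1..?n} - {i}.
          \<omega> {i, j} * ((q i $ 2 - q j $ 2) ^ t * (q i $ 1 - q j $ 1) ^ (CARD('d) - 1 - t)))" for i t
  have "?S = 0 \<longleftrightarrow> (\<forall>b::'n. \<forall>t::'d. f (position b + 1) (position t) = 0)"
    unfolding vec_eq_iff[where 'b = 'n] block
    by (simp add: vec_eq_iff f_def cofactor_vector_def)
  also have "\<dots> \<longleftrightarrow> (\<forall>b\<in>{..<?n}. \<forall>t\<in>{..<CARD('d)}. f (b + 1) t = 0)"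
    unfolding bij_betw_imp_surj_on[OF bij_betw_position[where 'a = 'n], symmetric]
      bij_betw_imp_surj_on[OF bij_betw_position[where 'a = 'd], symmetric] by simp
  also have "\<dots> \<longleftrightarrow> (\<forall>i\<in>(\<lambda>b. b + 1) ` {..<?n}. \<forall>t<CARD('d). f i t = 0)"
    by auto
  also have "(\<lambda>b. b + 1) ` {..<?n} = {1..?n}"
    by (simp add: image_Suc_lessThan)
  finally show ?thesis by (simp add: f_def)
qed

text \<open>The vanishing of divided differences on polynomials of low degree, in homogeneous form.
  Multiplying by the linear form that vanishes at a point \<open>v k\<close> removes that point, and the forms of
  two points span all linear forms.\<close>

lemma divided_difference_eq_0:
  fixes v :: "'i \<Rightarrow> real^2"
  assumes "finite J" "card J = a + b + 2"
    and "\<And>i j. i \<in> J \<Longrightarrow> j \<in> J \<Longrightarrow> i \<noteq> j \<Longrightarrow> cross2 (v i) (v j) \<noteq> 0"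
  shows "(\<Sum>j\<in>J. v j $ 1 ^ a * v j $ 2 ^ b / (\<Prod>l\<in>J - {j}. cross2 (v j) (v l))) = 0"
  using assms
proof (induction "a + b" arbitrary: a b J)
  case 0
  then have "card J = 2" by simp
  then obtain i j where J: "J = {i, j}" "i \<noteq> j" by (auto simp: card_2_iff)
  have "cross2 (v j) (v i) = - cross2 (v i) (v j)" by (simp add: cross2_def)
  then show ?case using J 0 by (simp add: insert_Diff_if)
next
  case (Suc m)
  define S where "S a b = (\<Sum>j\<in>J. v j $ 1 ^ a * v j $ 2 ^ b / (\<Prod>l\<in>J - {j}. cross2 (v j) (v l)))" for a b
  have cancel: "v k $ 2 * S (Suc a) b - v k $ 1 * S a (Suc b) = 0" if k: "k \<in> J" and ab: "a + b = m" for k a b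
  proof -
    have "v k $ 2 * S (Suc a) b - v k $ 1 * S a (Suc b)
        = (\<Sum>j\<in>J. cross2 (v j) (v k) * (v j $ 1 ^ a * v j $ 2 ^ b) / (\<Prod>l\<in>J - {j}. cross2 (v j) (v l)))"
      unfolding S_def sum_distrib_left sum_subtractf[symmetric]
      by (rule sum.cong) (simp_all add: cross2_def diff_divide_distrib algebra_simps)
    also have "\<dots> = (\<Sum>j\<in>J - {k}. cross2 (v j) (v k) * (v j $ 1 ^ a * v j $ 2 ^ b) / (\<Prod>l\<in>J - {j}. cross2 (v j) (v l)))"
      by (rule sum.mono_neutral_right) (use Suc.prems k in \<open>auto simp: cross2_def\<close>)
    also have "\<dots> = (\<Sum>j\<in>J - {k}. v j $ 1 ^ a * v j $ 2 ^ b / (\<Prod>l\<in>(J - {k}) - {j}. cross2 (v j) (v l)))"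
    proof (rule sum.cong[OF refl])
      fix j assume j: "j \<in> J - {k}"
      have "(\<Prod>l\<in>J - {j}. cross2 (v j) (v l)) = cross2 (v j) (v k) * (\<Prod>l\<in>(J - {j}) - {k}. cross2 (v j) (v l))"
        using j k Suc.prems by (intro prod.remove) auto
      moreover have "(J - {j}) - {k} = (J - {k}) - {j}" by blast
      moreover have "cross2 (v j) (v k) \<noteq> 0" using Suc.prems j k by auto
      ultimately show "cross2 (v j) (v k) * (v j $ 1 ^ a * v j $ 2 ^ b) / (\<Prod>l\<in>J - {j}. cross2 (v j) (v l))
        = v j $ 1 ^ a * v j $ 2 ^ b / (\<Prod>l\<in>(J - {k}) - {j}. cross2 (v j) (v l))"
        by simp
    qed
    also have "\<dots> = 0"
      using Suc.prems Suc.hyps(2) k ab by (intro Suc.hyps(1)) auto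
    finally show ?thesis .
  qed
  have "2 \<le> card J" using Suc.prems by simp
  then obtain i k where ik: "i \<in> J" "k \<in> J" "i \<noteq> k"
    by (metis card_2_iff' ex_card subsetD)
  then have ne: "cross2 (v i) (v k) \<noteq> 0" using Suc.prems by simp
  have zero: "S (Suc a) b = 0 \<and> S a (Suc b) = 0" if "a + b = m" for a b
  proof -
    have "cross2 (v i) (v k) * S (Suc a) b = 0" "cross2 (v i) (v k) * S a (Suc b) = 0"
      using cancel[OF ik(1) that] cancel[OF ik(2) that] unfolding cross2_def by algebra+
    then show ?thesis using ne by simp
  qed
  have "S a b = 0"
  proof (cases a)
    case 0
    then obtain b' where "b = Suc b'" "a + b' = m" using Suc.hyps(2) by (cases b) auto
    then show ?thesis using zero by blast
  next
    case (Suc a')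
    then show ?thesis using zero[of a' b] Suc.hyps(2) by simp
  qed
  then show ?case by (simp add: S_def)
qed

definition equilibrium :: "(nat \<Rightarrow> real^2) \<Rightarrow> (nat set \<Rightarrow> real) \<Rightarrow> nat \<Rightarrow> bool" where
  "equilibrium q \<omega> i \<longleftrightarrow> (\<forall>t<4. (\<Sum>j\<in>{1..7} - {i}.
     \<omega> {i, j} * ((q j - q i) $ 2 ^ t * (q j - q i) $ 1 ^ (3 - t))) = 0)"

lemma cofactor_row_relation_iff_equilibrium:
  "(\<Sum>e\<in>edges 7. \<omega> e *\<^sub>R (cofactor_row q e :: real^4^7)) = 0 \<longleftrightarrow> (\<forall>i\<in>{1..7}. equilibrium q \<omega> i)"
proof -
  have odd: "(x :: real) ^ t * y ^ (3 - t) = - ((- x) ^ t * (- y) ^ (3 - t))" if "t < 4" for x y t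
  proof -
    have "t = 0 \<or> t = 1 \<or> t = 2 \<or> t = 3" using that by auto
    then show ?thesis by (elim disjE) (simp_all add: power2_eq_square power3_eq_cube)
  qed
  have "\<omega> {i, j} * ((q i $ 2 - q j $ 2) ^ t * (q i $ 1 - q j $ 1) ^ (3 - t))
      = - (\<omega> {i, j} * ((q j - q i) $ 2 ^ t * (q j - q i) $ 1 ^ (3 - t)))" if "t < 4" for i j t
    unfolding odd[OF that, of "q i $ 2 - q j $ 2"] by simp
  then have "(\<Sum>j\<in>{1..7} - {i}. \<omega> {i, j} * ((q i $ 2 - q j $ 2) ^ t * (q i $ 1 - q j $ 1) ^ (3 - t)))
      = - (\<Sum>j\<in>{1..7} - {i}. \<omega> {i, j} * ((q j - q i) $ 2 ^ t * (q j - q i) $ 1 ^ (3 - t)))" if "t < 4" for i t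
    unfolding sum_negf[symmetric] using that by (intro sum.cong) auto
  then have eq: "((\<Sum>j\<in>{1..7} - {i}. \<omega> {i, j} * ((q i $ 2 - q j $ 2) ^ t * (q i $ 1 - q j $ 1) ^ (3 - t))) = 0)
      \<longleftrightarrow> (\<Sum>j\<in>{1..7} - {i}. \<omega> {i, j} * ((q j - q i) $ 2 ^ t * (q j - q i) $ 1 ^ (3 - t))) = 0" if "t < 4" for i t
    using that by simp
  show ?thesis
    using cofactor_row_relation[of \<omega> q, where 'd = 4 and 'n = 7] eq
    by (simp add: equilibrium_def del: One_nat_def)
qed

text \<open>For a vertex \<open>X = (q m, 1)\<close> one factor cancels, and this is the stress of the complete graph on
  the six vertices other than \<open>m\<close>.\<close>

definition stress :: "(nat \<Rightarrow> real^2) \<Rightarrow> (real^2) \<times> real \<Rightarrow> nat set \<Rightarrow> real" where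
  "stress q X e = line_form (q (Min e)) (q (Max e)) X
     / (\<Prod>l\<in>{1..7} - e. orient (q (Min e)) (q (Max e)) (q l))"

text \<open>Exchanging the two points changes the sign of the numerator and of each of the five factors of the
  denominator, hence not the value.\<close>

lemma stress_eq:
  assumes "i \<in> {1..7}" "j \<in> {1..7}" "i \<noteq> j"
  shows "stress q X {i, j} = line_form (q i) (q j) X / (\<Prod>l\<in>{1..7} - {i, j}. orient (q i) (q j) (q l))"
proof (cases "i < j")
  case True then show ?thesis by (simp add: stress_def)
next
  case False
  then have ji: "Min {i, j} = j" "Max {i, j} = i" using assms by auto
  have "card ({1..7} - {i, j}) = 5" using assms by (simp add: card_Diff_subset)
  then have "(\<Prod>l\<in>{1..7} - {i, j}. orient (q j) (q i) (q l)) = - (\<Prod>l\<in>{1..7} - {i, j}. orient (q i) (q j) (q l))"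
    by (simp add: orient_swap[of "q j" "q i"] prod_uminus)
  moreover have "line_form (q j) (q i) X = - line_form (q i) (q j) X"
    by (simp add: line_form_eq algebra_simps)
  ultimately show ?thesis by (simp add: stress_def ji)
qed

locale general_position =
  fixes q :: "nat \<Rightarrow> real^2"
  assumes not_collinear: "i \<in> {1..7} \<Longrightarrow> j \<in> {1..7} \<Longrightarrow> k \<in> {1..7} \<Longrightarrow> i \<noteq> j \<Longrightarrow> i \<noteq> k \<Longrightarrow> j \<noteq> k \<Longrightarrow>
    orient (q i) (q j) (q k) \<noteq> 0"
begin

text \<open>Seen from \<open>q i\<close>, the numerator is a linear form in the direction of the other vertex and the
  denominator is that of a divided difference over six directions. Multiplied by a cubic monomial the
  numerator has degree four, which the divided difference annihilates.\<close>

lemma stress_equilibrium: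
  assumes i: "i \<in> {1..7}"
  shows "equilibrium q (stress q X) i"
  unfolding equilibrium_def
proof (intro allI impI)
  fix t :: nat assume t: "t < 4"
  define v where "v j = q j - q i" for j
  define w where "w = fst X - snd X *\<^sub>R q i"
  define J where "J = {1..7} - {i}"
  have J: "finite J" "card J = 6" using i by (simp_all add: J_def)
  have ne: "cross2 (v j) (v k) \<noteq> 0" if "j \<in> J" "k \<in> J" "j \<noteq> k" for j k
    using not_collinear[OF i, of j k] that by (auto simp: v_def J_def orient_def)
  have st: "stress q X {i, j} = cross2 (v j) w / (\<Prod>l\<in>J - {j}. cross2 (v j) (v l))" if "j \<in> J" for j
  proof -
    have "{1..7} - {i, j} = J - {j}" by (auto simp: J_def)
    then show ?thesis using that stress_eq[OF i, of j q X]
      by (auto simp: line_form_def orient_def v_def w_def J_def)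
  qed
  have "(\<Sum>j\<in>J. stress q X {i, j} * (v j $ 2 ^ t * v j $ 1 ^ (3 - t)))
    = (\<Sum>j\<in>J. w $ 2 * (v j $ 1 ^ (4 - t) * v j $ 2 ^ t / (\<Prod>l\<in>J - {j}. cross2 (v j) (v l)))
        - w $ 1 * (v j $ 1 ^ (3 - t) * v j $ 2 ^ (t + 1) / (\<Prod>l\<in>J - {j}. cross2 (v j) (v l))))"
  proof (rule sum.cong[OF refl])
    fix j assume "j \<in> J"
    have "4 - t = Suc (3 - t)" using t by simp
    then have "v j $ 1 ^ (4 - t) = v j $ 1 * v j $ 1 ^ (3 - t)" by simp
    then show "stress q X {i, j} * (v j $ 2 ^ t * v j $ 1 ^ (3 - t)) =
      w $ 2 * (v j $ 1 ^ (4 - t) * v j $ 2 ^ t / (\<Prod>l\<in>J - {j}. cross2 (v j) (v l)))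
        - w $ 1 * (v j $ 1 ^ (3 - t) * v j $ 2 ^ (t + 1) / (\<Prod>l\<in>J - {j}. cross2 (v j) (v l)))"
      unfolding st[OF \<open>j \<in> J\<close>] by (simp add: cross2_def[of _ w] diff_divide_distrib algebra_simps)
  qed
  also have "\<dots> = 0"
    unfolding sum_subtractf sum_distrib_left[symmetric]
    using divided_difference_eq_0[of J "4 - t" t v] divided_difference_eq_0[of J "3 - t" "t + 1" v] J ne t
    by simp
  finally show "(\<Sum>j\<in>{1..7} - {i}. stress q X {i, j} * ((q j - q i) $ 2 ^ t * (q j - q i) $ 1 ^ (3 - t))) = 0"
    by (simp add: J_def v_def)
qed

text \<open>Four cubic forms separate four directions: the product of the linear forms vanishing at three
  of them isolates the fourth.\<close>

lemma equilibrium_four_neighbours: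
  assumes eq: "equilibrium q \<omega> i" and i: "i \<in> {1..7}"
    and K: "K \<subseteq> {1..7} - {i}" "card K = 4"
    and zero: "\<And>j. j \<in> {1..7} - {i} - K \<Longrightarrow> \<omega> {i, j} = 0"
    and j: "j \<in> {1..7} - {i}"
  shows "\<omega> {i, j} = 0"
proof (cases "j \<in> K")
  case True
  define v where "v j = q j - q i" for j
  define J where "J = {1..7} - {i}"
  have J: "finite J" by (simp add: J_def)
  have "card (K - {j}) = 3" using K True by (simp add: card_Diff_subset)
  then obtain a b c where abc: "K - {j} = {a, b, c}" by (auto simp: card_3_iff)
  define P where "P l = cross2 (v l) (v a) * cross2 (v l) (v b) * cross2 (v l) (v c)" for l
  have s: "(\<Sum>l\<in>J. \<omega> {i, l} * (v l $ 2 ^ t * v l $ 1 ^ (3 - t))) = 0" if "t < 4" for t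
    using eq that by (simp add: equilibrium_def J_def v_def)
  have "\<omega> {i, l} * P l
      = v a $ 2 * v b $ 2 * v c $ 2 * (\<omega> {i, l} * (v l $ 2 ^ 0 * v l $ 1 ^ (3 - 0)))
      - (v a $ 1 * v b $ 2 * v c $ 2 + v a $ 2 * v b $ 1 * v c $ 2 + v a $ 2 * v b $ 2 * v c $ 1)
        * (\<omega> {i, l} * (v l $ 2 ^ 1 * v l $ 1 ^ (3 - 1)))
      + (v a $ 2 * v b $ 1 * v c $ 1 + v a $ 1 * v b $ 2 * v c $ 1 + v a $ 1 * v b $ 1 * v c $ 2)
        * (\<omega> {i, l} * (v l $ 2 ^ 2 * v l $ 1 ^ (3 - 2)))
      - v a $ 1 * v b $ 1 * v c $ 1 * (\<omega> {i, l} * (v l $ 2 ^ 3 * v l $ 1 ^ (3 - 3)))" for l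
    by (simp add: P_def cross2_def power2_eq_square power3_eq_cube algebra_simps)
  then have "(\<Sum>l\<in>J. \<omega> {i, l} * P l) = 0"
    by (simp only: sum.distrib sum_subtractf sum_distrib_left[symmetric] s)
  moreover have "(\<Sum>l\<in>J. \<omega> {i, l} * P l) = (\<Sum>l\<in>{j}. \<omega> {i, l} * P l)"
  proof (rule sum.mono_neutral_right)
    have "P l = 0" if "l \<in> {a, b, c}" for l using that by (auto simp: P_def cross2_def)
    moreover have "\<omega> {i, l} = 0" if "l \<in> J - K" for l using that zero by (auto simp: J_def)
    ultimately show "\<forall>l\<in>J - {j}. \<omega> {i, l} * P l = 0" using abc by auto
  qed (use J j in \<open>auto simp: J_def\<close>)
  moreover have "P j \<noteq> 0"
  proof -
    have "cross2 (v j) (v k) \<noteq> 0" if "k \<in> K - {j}" for k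
    proof -
      have "k \<in> {1..7}" "k \<noteq> i" using K(1) that by auto
      then show ?thesis using not_collinear[OF i, of j k] j that by (auto simp: v_def orient_def)
    qed
    then show ?thesis using abc by (simp add: P_def)
  qed
  ultimately show ?thesis by simp
qed (use zero j in auto)

text \<open>The vertices \<open>5\<close>, \<open>6\<close>, \<open>7\<close> have only four neighbours outside the triangle that they form. Once
  the edges at these vertices are gone, every other vertex has three neighbours left.\<close>

lemma equilibrium_zero_on_triangle:
  assumes eq: "\<And>i. i \<in> {1..7} \<Longrightarrow> equilibrium q \<omega> i"
    and tri: "\<omega> {5, 6} = 0" "\<omega> {5, 7} = 0" "\<omega> {6, 7} = 0"
    and e: "e \<in> edges 7"
  shows "\<omega> e = 0"
proof -
  have high: "\<omega> {i, j} = 0" if "i \<in> {5,6,7}" "j \<in> {1..7} - {i}" for i j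
  proof (rule equilibrium_four_neighbours[OF eq])
    show "{1,2,3,4} \<subseteq> {1..7} - {i}" using that by auto
    fix l assume "l \<in> {1..7} - {i} - {1,2,3,4}"
    then have "l \<in> {5,6,7} - {i}" by auto
    then show "\<omega> {i, l} = 0" using that(1) tri by (auto simp: insert_commute)
  qed (use that in auto)
  have low: "\<omega> {i, j} = 0" if "i \<in> {1..4}" "j \<in> {1..7} - {i}" for i j
  proof (rule equilibrium_four_neighbours[OF eq])
    show "{1..5} - {i} \<subseteq> {1..7} - {i}" by auto
    show "card ({1..5} - {i}) = 4" using that by simp
    fix l assume "l \<in> {1..7} - {i} - ({1..5} - {i})"
    then have "l \<in> {5,6,7}" by auto
    then show "\<omega> {i, l} = 0" using high[of l i] that(1) by (auto simp: insert_commute)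
  qed (use that in auto)
  obtain i j where ij: "e = {i, j}" "i \<in> {1..7}" "j \<in> {1..7} - {i}"
    using e by (auto simp: edges_def card_2_iff)
  then have "i \<in> {5,6,7} \<or> i \<in> {1..4}" by auto
  then show ?thesis using high[OF _ ij(3)] low[OF _ ij(3)] ij(1) by blast
qed

text \<open>Every relation is a stress: the values on one triangle can be matched, because the forms of
  its three sides are linearly independent, and the difference vanishes.\<close>

lemma equilibrium_imp_stress:
  assumes eq: "\<And>i. i \<in> {1..7} \<Longrightarrow> equilibrium q \<omega> i"
  shows "\<exists>X. \<forall>e\<in>edges 7. \<omega> e = stress q X e"
proof -
  define D where "D i j = (\<Prod>l\<in>{1..7} - {i, j}. orient (q i) (q j) (q l))" for i j
  define d where "d = orient (q 5) (q 6) (q 7)"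
  have d: "d \<noteq> 0" unfolding d_def by (rule not_collinear) auto
  have D: "D i j \<noteq> 0" if "i \<in> {1..7}" "j \<in> {1..7}" "i \<noteq> j" for i j
    unfolding D_def using not_collinear that by (auto simp: prod_zero_iff)
  have st: "stress q X {i, j} = line_form (q i) (q j) X / D i j"
    if "i \<in> {1..7}" "j \<in> {1..7}" "i \<noteq> j" for i j X
    unfolding D_def using that by (rule stress_eq)
  define X where "X = (\<omega> {6, 7} * D 6 7 / d) *\<^sub>R (q 5, 1) + (- \<omega> {5, 7} * D 5 7 / d) *\<^sub>R (q 6, 1)
    + (\<omega> {5, 6} * D 5 6 / d) *\<^sub>R (q 7, 1 :: real)"
  have "orient (q 6) (q 7) (q 5) = d" "orient (q 5) (q 7) (q 6) = - d" "orient (q 5) (q 6) (q 7) = d"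
    by (simp_all add: d_def orient_eq algebra_simps)
  then have "line_form (q 6) (q 7) X = \<omega> {6, 7} * D 6 7" "line_form (q 5) (q 7) X = \<omega> {5, 7} * D 5 7"
    "line_form (q 5) (q 6) X = \<omega> {5, 6} * D 5 6"
    unfolding X_def line_form_add line_form_scaleR line_form_point using d by simp_all
  then have tri: "\<omega> {6, 7} = stress q X {6, 7}" "\<omega> {5, 7} = stress q X {5, 7}" "\<omega> {5, 6} = stress q X {5, 6}"
    using D[of 6 7] D[of 5 7] D[of 5 6] by (simp_all add: st)
  define \<delta> where "\<delta> e = \<omega> e - stress q X e" for e
  have "equilibrium q \<delta> i" if "i \<in> {1..7}" for i
    using eq[OF that] stress_equilibrium[OF that, of X]
    by (simp add: equilibrium_def \<delta>_def left_diff_distrib sum_subtractf)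
  then have "\<delta> e = 0" if "e \<in> edges 7" for e
    by (rule equilibrium_zero_on_triangle) (use tri that in \<open>simp_all add: \<delta>_def\<close>)
  then have "\<forall>e\<in>edges 7. \<omega> e = stress q X e" by (simp add: \<delta>_def)
  then show ?thesis by blast
qed

lemma cofactor_row_relation_iff_stress:
  "(\<Sum>e\<in>edges 7. \<omega> e *\<^sub>R (cofactor_row q e :: real^4^7)) = 0 \<longleftrightarrow> (\<exists>X. \<forall>e\<in>edges 7. \<omega> e = stress q X e)"
proof
  assume "(\<Sum>e\<in>edges 7. \<omega> e *\<^sub>R (cofactor_row q e :: real^4^7)) = 0"
  then have eq: "equilibrium q \<omega> i" if "i \<in> {1..7}" for i
    using that unfolding cofactor_row_relation_iff_equilibrium by simp
  show "\<exists>X. \<forall>e\<in>edges 7. \<omega> e = stress q X e"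
    by (rule equilibrium_imp_stress[OF eq])
next
  assume "\<exists>X. \<forall>e\<in>edges 7. \<omega> e = stress q X e"
  then obtain X where X: "\<forall>e\<in>edges 7. \<omega> e = stress q X e" by blast
  have "(\<Sum>e\<in>edges 7. stress q X e *\<^sub>R (cofactor_row q e :: real^4^7)) = 0"
    unfolding cofactor_row_relation_iff_equilibrium using stress_equilibrium by blast
  moreover have "(\<Sum>e\<in>edges 7. \<omega> e *\<^sub>R (cofactor_row q e :: real^4^7)) = (\<Sum>e\<in>edges 7. stress q X e *\<^sub>R cofactor_row q e)"
    using X by (intro sum.cong) auto
  ultimately show "(\<Sum>e\<in>edges 7. \<omega> e *\<^sub>R (cofactor_row q e :: real^4^7)) = 0" by simp
qed

end

section \<open>A coefficient criterion for complete simplicial fans\<close>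

lemma convex_cone_hull_image_eq:
  fixes v :: "'e \<Rightarrow> 'v::real_vector"
  assumes "finite F"
  shows "convex_cone hull (v ` F) = {\<Sum>e\<in>F. c e *\<^sub>R v e |c. \<forall>e\<in>F. 0 \<le> c e}" (is "?L = ?R")
proof
  show "?L \<subseteq> ?R"
  proof (rule hull_minimal)
    show "v ` F \<subseteq> ?R"
    proof (rule image_subsetI)
      fix f assume "f \<in> F"
      have "v f = (\<Sum>e\<in>F. (if e = f then 1 else 0) *\<^sub>R v e)"
        using assms \<open>f \<in> F\<close> by (simp add: if_distrib[of "\<lambda>x. x *\<^sub>R _"] sum.delta cong: if_cong)
      then show "v f \<in> ?R" by (intro CollectI exI[of _ "\<lambda>e. if e = f then 1 else 0"]) auto
    qed
    show "convex_cone ?R"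
      unfolding convex_cone_iff
    proof (intro conjI ballI allI impI)
      show "0 \<in> ?R" by (intro CollectI exI[of _ "\<lambda>_. 0"]) auto
    next
      fix x y assume "x \<in> ?R" "y \<in> ?R"
      then obtain c d where "x = (\<Sum>e\<in>F. c e *\<^sub>R v e)" "y = (\<Sum>e\<in>F. d e *\<^sub>R v e)"
        "\<forall>e\<in>F. 0 \<le> c e" "\<forall>e\<in>F. 0 \<le> d e" by blast
      then show "x + y \<in> ?R"
        by (intro CollectI exI[of _ "\<lambda>e. c e + d e"]) (simp add: scaleR_left_distrib sum.distrib)
    next
      fix x and r :: real assume "x \<in> ?R" "0 \<le> r"
      then obtain c where "x = (\<Sum>e\<in>F. c e *\<^sub>R v e)" "\<forall>e\<in>F. 0 \<le> c e" by blast
      then show "r *\<^sub>R x \<in> ?R" using \<open>0 \<le> r\<close>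
        by (intro CollectI exI[of _ "\<lambda>e. r * c e"]) (simp add: scaleR_sum_right)
    qed
  qed
  show "?R \<subseteq> ?L"
  proof
    fix x assume "x \<in> ?R"
    then obtain c where x: "x = (\<Sum>e\<in>F. c e *\<^sub>R v e)" and c: "\<forall>e\<in>F. 0 \<le> c e" by blast
    have "(\<Sum>e\<in>G. c e *\<^sub>R v e) \<in> ?L" if "G \<subseteq> F" for G
      using finite_subset[OF that assms] that
    proof (induction G rule: finite_induct)
      case empty then show ?case by (simp add: convex_cone_hull_contains_0)
    next
      case (insert e G)
      then have "c e *\<^sub>R v e \<in> ?L" using c by (intro convex_cone_hull_mul hull_inc) auto
      then show ?case using insert by (simp add: convex_cone_hull_add)
    qed
    then show "x \<in> ?L" using x by blast
  qed
qed

lemma in_span_image: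
  fixes v :: "'e \<Rightarrow> 'v::real_vector"
  assumes "finite F" "x \<in> span (v ` F)"
  obtains b where "x = (\<Sum>e\<in>F. b e *\<^sub>R v e)"
proof -
  let ?R = "{x. \<exists>b. x = (\<Sum>e\<in>F. b e *\<^sub>R v e)}"
  have "span (v ` F) \<subseteq> ?R"
  proof (rule span_minimal)
    show "v ` F \<subseteq> ?R"
    proof (rule image_subsetI)
      fix f assume "f \<in> F"
      have "v f = (\<Sum>e\<in>F. (if e = f then 1 else 0) *\<^sub>R v e)"
        using assms \<open>f \<in> F\<close> by (simp add: if_distrib[of "\<lambda>x. x *\<^sub>R _"] sum.delta cong: if_cong)
      then show "v f \<in> ?R" by (intro CollectI exI)
    qed
    show "subspace ?R"
      unfolding subspace_def
    proof (intro conjI ballI allI)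
      show "0 \<in> ?R" by (intro CollectI exI[of _ "\<lambda>_. 0"]) simp
    next
      fix x y assume "x \<in> ?R" "y \<in> ?R"
      then obtain c d where "x = (\<Sum>e\<in>F. c e *\<^sub>R v e)" "y = (\<Sum>e\<in>F. d e *\<^sub>R v e)" by blast
      then show "x + y \<in> ?R"
        by (intro CollectI exI[of _ "\<lambda>e. c e + d e"]) (simp add: scaleR_left_distrib sum.distrib)
    next
      fix x and r :: real assume "x \<in> ?R"
      then obtain c where "x = (\<Sum>e\<in>F. c e *\<^sub>R v e)" by blast
      then show "r *\<^sub>R x \<in> ?R"
        by (intro CollectI exI[of _ "\<lambda>e. r * c e"]) (simp add: scaleR_sum_right)
    qed
  qed
  then show ?thesis using assms(2) that by blast
qed

text \<open>Extending the coefficients of a point of a cone by zero, points of cones of faces become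
  nonnegative vectors supported on a face. Existence of such a representation is completeness.
  Uniqueness yields the intersection condition, and, applied to the positive and the negative part of
  a relation, also independence.\<close>

lemma complete_simplicial_fanI:
  fixes v :: "'e \<Rightarrow> 'v::real_vector"
  assumes E: "finite E" and sub: "\<And>F. F \<in> \<Delta> \<Longrightarrow> F \<subseteq> E"
    and down: "\<And>F G. F \<in> \<Delta> \<Longrightarrow> G \<subseteq> F \<Longrightarrow> G \<in> \<Delta>"
    and ex: "\<And>b. \<exists>c. (\<forall>e\<in>E. 0 \<le> c e) \<and> {e\<in>E. c e \<noteq> 0} \<in> \<Delta>
      \<and> (\<Sum>e\<in>E. c e *\<^sub>R v e) = (\<Sum>e\<in>E. b e *\<^sub>R v e)"
    and uniq: "\<And>c c'. (\<And>e. e \<in> E \<Longrightarrow> 0 \<le> c e) \<Longrightarrow> (\<And>e. e \<in> E \<Longrightarrow> 0 \<le> c' e)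
      \<Longrightarrow> {e\<in>E. c e \<noteq> 0} \<in> \<Delta> \<Longrightarrow> {e\<in>E. c' e \<noteq> 0} \<in> \<Delta>
      \<Longrightarrow> (\<Sum>e\<in>E. c e *\<^sub>R v e) = (\<Sum>e\<in>E. c' e *\<^sub>R v e) \<Longrightarrow> (\<And>e. e \<in> E \<Longrightarrow> c e = c' e)"
  shows "complete_simplicial_fan \<Delta> v (span (v ` E))"
proof -
  have finF: "finite F" if "F \<in> \<Delta>" for F using E sub[OF that] by (rule finite_subset[rotated])
  have cone: "convex_cone hull (v ` F) = {\<Sum>e\<in>F. c e *\<^sub>R v e |c. \<forall>e\<in>F. 0 \<le> c e}" if "F \<in> \<Delta>" for F
    using finF[OF that] by (rule convex_cone_hull_image_eq)
  have extend: "(\<Sum>e\<in>F. c e *\<^sub>R v e) = (\<Sum>e\<in>E. (if e \<in> F then c e else 0) *\<^sub>R v e)" if "F \<in> \<Delta>" for F c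
  proof -
    have "(\<Sum>e\<in>F. c e *\<^sub>R v e) = (\<Sum>e\<in>F. (if e \<in> F then c e else 0) *\<^sub>R v e)"
      by (rule sum.cong) auto
    also have "\<dots> = (\<Sum>e\<in>E. (if e \<in> F then c e else 0) *\<^sub>R v e)"
      by (rule sum.mono_neutral_left) (use E sub[OF that] in auto)
    finally show ?thesis .
  qed
  have uniqF: "\<forall>e\<in>E. (if e \<in> F then c e else 0) = (if e \<in> G then c' e else 0)"
    if "F \<in> \<Delta>" "G \<in> \<Delta>" "\<forall>e\<in>F. 0 \<le> c e" "\<forall>e\<in>G. 0 \<le> c' e"
      "(\<Sum>e\<in>F. c e *\<^sub>R v e) = (\<Sum>e\<in>G. c' e *\<^sub>R v e)" for F G c c'
  proof
    fix e assume "e \<in> E"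
    have "{e\<in>E. (if e \<in> F then c e else 0) \<noteq> 0} \<in> \<Delta>" by (rule down[OF that(1)]) (auto split: if_splits)
    moreover have "{e\<in>E. (if e \<in> G then c' e else 0) \<noteq> 0} \<in> \<Delta>"
      by (rule down[OF that(2)]) (auto split: if_splits)
    ultimately show "(if e \<in> F then c e else 0) = (if e \<in> G then c' e else 0)"
      using that \<open>e \<in> E\<close> extend
      by (intro uniq[of "\<lambda>e. if e \<in> F then c e else 0" "\<lambda>e. if e \<in> G then c' e else 0"]) auto
  qed
  have indep: "inj_on v F \<and> independent (v ` F)" if F: "F \<in> \<Delta>" for F
  proof
    show inj: "inj_on v F"
    proof (rule inj_onI, rule ccontr)
      fix e f assume ef: "e \<in> F" "f \<in> F" "v e = v f" "e \<noteq> f"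
      have "{e} \<in> \<Delta>" "{f} \<in> \<Delta>" using down[OF F] ef by auto
      then have "\<forall>x\<in>E. (if x \<in> {e} then 1 else 0 :: real) = (if x \<in> {f} then 1 else 0)"
        by (rule uniqF[of _ _ "\<lambda>_. 1" "\<lambda>_. 1"]) (use ef in auto)
      then show False using ef sub[OF F] by (auto dest: bspec[of _ _ e])
    qed
    show "independent (v ` F)"
    proof (rule independent_if_scalars_zero)
      show "finite (v ` F)" using finF[OF F] by simp
      fix f x assume f: "(\<Sum>x\<in>v ` F. f x *\<^sub>R x) = 0" and x: "x \<in> v ` F"
      define c where "c e = max 0 (f (v e))" for e
      define c' where "c' e = max 0 (- f (v e))" for e
      have "(\<Sum>e\<in>F. c e *\<^sub>R v e) - (\<Sum>e\<in>F. c' e *\<^sub>R v e) = (\<Sum>e\<in>F. f (v e) *\<^sub>R v e)"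
        unfolding sum_subtractf[symmetric]
        by (rule sum.cong) (auto simp: c_def c'_def max_def scaleR_left_diff_distrib[symmetric])
      also have "\<dots> = 0" using f inj by (simp add: sum.reindex)
      finally have "\<forall>e\<in>E. (if e \<in> F then c e else 0) = (if e \<in> F then c' e else 0)"
        by (intro uniqF F) (auto simp: c_def c'_def)
      then have "\<forall>e\<in>F. c e = c' e" using sub[OF F] by fastforce
      then show "f x = 0" using x by (auto simp: c_def c'_def max_def split: if_splits)
    qed
  qed
  have inter: "convex_cone hull (v ` F) \<inter> convex_cone hull (v ` G) = convex_cone hull (v ` (F \<inter> G))"
    if FG: "F \<in> \<Delta>" "G \<in> \<Delta>" for F G
  proof
    show "convex_cone hull (v ` (F \<inter> G)) \<subseteq> convex_cone hull (v ` F) \<inter> convex_cone hull (v ` G)"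
      by (simp add: hull_mono image_mono)
    show "convex_cone hull (v ` F) \<inter> convex_cone hull (v ` G) \<subseteq> convex_cone hull (v ` (F \<inter> G))"
    proof
      fix x assume "x \<in> convex_cone hull (v ` F) \<inter> convex_cone hull (v ` G)"
      then obtain c c' where x: "x = (\<Sum>e\<in>F. c e *\<^sub>R v e)" "x = (\<Sum>e\<in>G. c' e *\<^sub>R v e)"
        and c: "\<forall>e\<in>F. 0 \<le> c e" "\<forall>e\<in>G. 0 \<le> c' e"
        unfolding cone[OF FG(1)] cone[OF FG(2)] by blast
      have eq: "\<forall>e\<in>E. (if e \<in> F then c e else 0) = (if e \<in> G then c' e else 0)"
        using uniqF[OF FG c] x by simp
      have "c e = 0" if "e \<in> F - F \<inter> G" for e
      proof -
        have "e \<in> E" using that sub[OF FG(1)] by blast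
        then show ?thesis using bspec[OF eq, of e] that by simp
      qed
      then have "(\<Sum>e\<in>F. c e *\<^sub>R v e) = (\<Sum>e\<in>F \<inter> G. c e *\<^sub>R v e)"
        by (intro sum.mono_neutral_right finF[OF FG(1)]) auto
      moreover have "F \<inter> G \<in> \<Delta>" using down[OF FG(1)] by blast
      ultimately show "x \<in> convex_cone hull (v ` (F \<inter> G))"
        using x(1) c(1) cone by auto
    qed
  qed
  have cover: "(\<Union>F\<in>\<Delta>. convex_cone hull (v ` F)) = span (v ` E)"
  proof
    show "(\<Union>F\<in>\<Delta>. convex_cone hull (v ` F)) \<subseteq> span (v ` E)"
    proof (rule UN_least)
      fix F assume "F \<in> \<Delta>"
      then have "v ` F \<subseteq> span (v ` E)" using sub span_superset[of "v ` E"] by blast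
      then show "convex_cone hull (v ` F) \<subseteq> span (v ` E)"
        by (intro hull_minimal convex_cone_span)
    qed
    show "span (v ` E) \<subseteq> (\<Union>F\<in>\<Delta>. convex_cone hull (v ` F))"
    proof
      fix x assume "x \<in> span (v ` E)"
      then obtain b where b: "x = (\<Sum>e\<in>E. b e *\<^sub>R v e)" using in_span_image[OF E] by blast
      obtain c where c: "\<forall>e\<in>E. 0 \<le> c e" "{e\<in>E. c e \<noteq> 0} \<in> \<Delta>"
        "(\<Sum>e\<in>E. c e *\<^sub>R v e) = (\<Sum>e\<in>E. b e *\<^sub>R v e)" using ex[of b] by blast
      have "(\<Sum>e\<in>E. c e *\<^sub>R v e) = (\<Sum>e\<in>{e\<in>E. c e \<noteq> 0}. c e *\<^sub>R v e)"
        by (rule sum.mono_neutral_right) (use E in auto)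
      then have "x \<in> convex_cone hull (v ` {e\<in>E. c e \<noteq> 0})"
        unfolding cone[OF c(2)] using b c by (intro CollectI exI[of _ c]) auto
      then show "x \<in> (\<Union>F\<in>\<Delta>. convex_cone hull (v ` F))" using c(2) by blast
    qed
  qed
  show ?thesis unfolding complete_simplicial_fan_def using indep inter cover by blast
qed

section \<open>The complex for the heptagon\<close>

definition long_edge :: "nat \<Rightarrow> nat set" where
  "long_edge u = {u mod 7 + 1, (u + 3) mod 7 + 1}"

lemma long_edge_simps:
  "long_edge 0 = {1, 4}" "long_edge 1 = {2, 5}" "long_edge 2 = {3, 6}" "long_edge 3 = {4, 7}"
  "long_edge 4 = {1, 5}" "long_edge 5 = {2, 6}" "long_edge 6 = {3, 7}"
  by (auto simp: long_edge_def)

lemma long_edge_mod: "long_edge (u mod 7) = long_edge u"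
  by (simp add: long_edge_def mod_add_left_eq)

lemma lessThan_7: "{..<7::nat} = {0, 1, 2, 3, 4, 5, 6}"
  by auto

lemma range_long_edge: "range long_edge = long_edge ` {..<7}"
proof -
  have "long_edge u \<in> long_edge ` {..<7}" for u
    by (rule image_eqI[of _ _ "u mod 7"]) (simp_all add: long_edge_mod)
  then show ?thesis by blast
qed

lemma crossing_iff:
  assumes "i < j" "a < b"
  shows "crossing {i, j} {a, b} \<longleftrightarrow> i < a \<and> a < j \<and> j < b \<or> a < i \<and> i < b \<and> b < j"
  using assms unfolding crossing_def by (auto simp: doubleton_eq_iff)

lemma crossing_long_edge:
  assumes "u < 7" "v < 7"
  shows "crossing (long_edge u) (long_edge v) \<longleftrightarrow> (u + 7 - v) mod 7 \<in> {1, 2, 5, 6}"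
  using less_7_cases[OF assms(1)] less_7_cases[OF assms(2)]
  by (elim disjE; simp only: long_edge_simps crossing_iff; simp add: crossing_iff)

lemma inj_on_long_edge: "inj_on long_edge {..<7}"
  unfolding lessThan_7 inj_on_def 
  by (simp add: long_edge_simps[unfolded One_nat_def] doubleton_eq_iff)

lemma long_edges_eq: "{e \<in> edges 7. 2 + 1 \<le> edge_length 7 e} = range long_edge"
proof (intro set_eqI iffI)
  fix e assume e: "e \<in> {e \<in> edges 7. 2 + 1 \<le> edge_length 7 e}"
  then obtain x y where "e = {x, y}" "x \<noteq> y" by (auto simp: edges_def card_2_iff)
  then obtain i j where ij: "e = {i, j}" "i < j" by (metis insert_commute linorder_neqE_nat)
  then have bounds: "1 \<le> i" "j \<le> 7" using e by (auto simp: edges_def)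
  have "3 \<le> j - i" "j - i \<le> 4"
    using e ij by (auto simp: edge_length_def)
  then have "j = i + 3 \<or> j = i + 4" using ij(2) by linarith
  moreover have "i = 1 \<or> i = 2 \<or> i = 3 \<or> i = 4" using \<open>3 \<le> j - i\<close> bounds by linarith
  ultimately have "i = 1 \<and> j = 4 \<or> i = 2 \<and> j = 5 \<or> i = 3 \<and> j = 6 \<or> i = 4 \<and> j = 7
      \<or> i = 1 \<and> j = 5 \<or> i = 2 \<and> j = 6 \<or> i = 3 \<and> j = 7"
    using bounds by (elim disjE) simp_all
  then have "e = {1, 4} \<or> e = {2, 5} \<or> e = {3, 6} \<or> e = {4, 7} \<or> e = {1, 5} \<or> e = {2, 6} \<or> e = {3, 7}"
    unfolding ij(1) by (elim disjE) simp_all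
  then show "e \<in> range long_edge"
    unfolding long_edge_simps[symmetric] by (elim disjE) simp_all
next
  fix e assume "e \<in> range long_edge"
  then have "e \<in> long_edge ` {..<7}" by (simp only: range_long_edge)
  then show "e \<in> {e \<in> edges 7. 2 + 1 \<le> edge_length 7 e}"
    unfolding lessThan_7 by (auto simp: long_edge_simps[unfolded One_nat_def] edges_def edge_length_def)
qed

lemma multiassociahedron_2_7:
  "F \<in> multiassociahedron 2 7 \<longleftrightarrow> F \<subseteq> range long_edge \<and>
     (\<forall>u. long_edge u \<notin> F \<or> long_edge (u + 1) \<notin> F \<or> long_edge (u + 2) \<notin> F)"
proof -
  have "(\<exists>S\<subseteq>F. card S = 2 + 1 \<and> pairwise crossing S) \<longleftrightarrow>
      (\<exists>u. long_edge u \<in> F \<and> long_edge (u + 1) \<in> F \<and> long_edge (u + 2) \<in> F)"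
    if F: "F \<subseteq> range long_edge"
  proof
    assume "\<exists>S\<subseteq>F. card S = 2 + 1 \<and> pairwise crossing S"
    then obtain S where S: "S \<subseteq> F" "card S = 3" "pairwise crossing S" by auto
    then obtain x y z where xyz: "S = {x, y, z}" "x \<noteq> y" "y \<noteq> z" "x \<noteq> z" by (auto simp: card_3_iff)
    have mem: "w \<in> long_edge ` {..<7}" if "w \<in> S" for w
      using F S(1) that unfolding range_long_edge by blast
    obtain a b c where abc: "x = long_edge a" "y = long_edge b" "z = long_edge c" "a < 7" "b < 7" "c < 7"
      using mem[of x] mem[of y] mem[of z] xyz by auto
    have "crossing x y" "crossing y z" "crossing x z"
      using S(3) xyz by (auto simp: pairwise_def)
    then have d: "(a + 7 - b) mod 7 \<in> {1, 2, 5, 6}" "(b + 7 - c) mod 7 \<in> {1, 2, 5, 6}"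
      "(a + 7 - c) mod 7 \<in> {1, 2, 5, 6}" using abc by (simp_all only: crossing_long_edge)
    define P where "P u \<longleftrightarrow> (u + 1) mod 7 \<in> {a, b, c} \<and> (u + 2) mod 7 \<in> {a, b, c}" for u
    have "P a \<or> P b \<or> P c"
      unfolding P_def using less_7_cases[OF abc(4)] less_7_cases[OF abc(5)] less_7_cases[OF abc(6)] d
      by (elim disjE; hypsubst; simp)
    then obtain u where "u \<in> {a, b, c}" "P u" by blast
    then have "{u, (u + 1) mod 7, (u + 2) mod 7} \<subseteq> {a, b, c}" by (simp only: P_def insert_subset empty_subsetI)
    then have "{long_edge u, long_edge ((u + 1) mod 7), long_edge ((u + 2) mod 7)} \<subseteq> S"
      using xyz abc by blast
    then show "\<exists>u. long_edge u \<in> F \<and> long_edge (u + 1) \<in> F \<and> long_edge (u + 2) \<in> F"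
      unfolding long_edge_mod using S(1) by blast
  next
    assume "\<exists>u. long_edge u \<in> F \<and> long_edge (u + 1) \<in> F \<and> long_edge (u + 2) \<in> F"
    then obtain u where u: "long_edge u \<in> F" "long_edge (u + 1) \<in> F" "long_edge (u + 2) \<in> F" by blast
    let ?a = "u mod 7" and ?b = "(u + 1) mod 7" and ?c = "(u + 2) mod 7"
    let ?S = "long_edge ` {?a, ?b, ?c}"
    have "?S \<subseteq> F" using u by (simp add: long_edge_mod)
    moreover have lt: "?a < 7" "?b < 7" "?c < 7" by simp_all
    have abc: "(?a + 7 - ?b) mod 7 \<in> {1, 2, 5, 6}" "(?b + 7 - ?a) mod 7 \<in> {1, 2, 5, 6}" 
      "(?b + 7 - ?c) mod 7 \<in> {1, 2, 5, 6}" "(?c + 7 - ?b) mod 7 \<in> {1, 2, 5, 6}"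
      "(?a + 7 - ?c) mod 7 \<in> {1, 2, 5, 6}" "(?c + 7 - ?a) mod 7 \<in> {1, 2, 5, 6}"
      and ne: "?a \<noteq> ?b" "?b \<noteq> ?c" "?a \<noteq> ?c"
      unfolding mod_add_left_eq[of u 7 1, symmetric] mod_add_left_eq[of u 7 2, symmetric]
      using less_7_cases[OF lt(1)] by (elim disjE; simp)+
    have "crossing (long_edge ?a) (long_edge ?b)" "crossing (long_edge ?b) (long_edge ?a)"
      "crossing (long_edge ?b) (long_edge ?c)" "crossing (long_edge ?c) (long_edge ?b)"
      "crossing (long_edge ?a) (long_edge ?c)" "crossing (long_edge ?c) (long_edge ?a)"
      using abc lt by (simp_all only: crossing_long_edge)
    then have "pairwise crossing ?S" unfolding pairwise_def by blast
    moreover have "card ?S = 2 + 1"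
      using ne lt card_image[OF inj_on_subset[OF inj_on_long_edge, of "{?a, ?b, ?c}"]] by simp
    ultimately show "\<exists>S\<subseteq>F. card S = 2 + 1 \<and> pairwise crossing S" by blast
  qed
  then show ?thesis
    unfolding multiassociahedron_def long_edges_eq mem_Collect_eq by blast
qed

section \<open>The fan of the cofactor rows\<close>

definition scale_x :: "real \<Rightarrow> real^2 \<Rightarrow> real^2" where
  "scale_x s p = vector [s * p $ 1, p $ 2]"

lemma scale_x_component [simp]: "scale_x s p $ 1 = s * p $ 1" "scale_x s p $ 2 = p $ 2"
  by (simp_all add: scale_x_def vector_2)

lemma orient_scale_x: "orient (scale_x s a) (scale_x s b) (scale_x s c) = s * orient a b c"
  by (simp add: orient_eq algebra_simps)

lemma line_form_scale_x:
  "line_form (scale_x s a) (scale_x s b) (scale_x s (fst X), snd X) = s * line_form a b X"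
  by (simp add: line_form_eq algebra_simps)

text \<open>A negatively oriented heptagon is replaced by its mirror image. This changes the sign of all
  line forms at once, which does not change the set of their simultaneous values.\<close>

lemma convex_position_heptagon:
  fixes q :: "nat \<Rightarrow> real^2"
  assumes "convex_position 7 q"
  obtains s :: real and Q where "s = 1 \<or> s = - 1" "convex_heptagon Q"
    "\<And>i j k. i < j \<Longrightarrow> j < k \<Longrightarrow> k < i + 7 \<Longrightarrow>
      0 < s * orient (cyclic_points 7 q i) (cyclic_points 7 q j) (cyclic_points 7 q k)"
    "\<And>X. \<exists>Y. \<forall>u. s * line_form (cyclic_points 7 q u) (cyclic_points 7 q (u + 3)) X = convex_heptagon.diag Q u Y"
    "\<And>Y. \<exists>X. \<forall>u. convex_heptagon.diag Q u Y = s * line_form (cyclic_points 7 q u) (cyclic_points 7 q (u + 3)) X"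
proof -
  obtain s :: real where s: "s = 1 \<or> s = - 1"
    and pos: "\<And>i j k. i < j \<Longrightarrow> j < k \<Longrightarrow> k < i + 7 \<Longrightarrow>
      0 < s * orient (cyclic_points 7 q i) (cyclic_points 7 q j) (cyclic_points 7 q k)"
    using convex_position_orient[OF assms] by auto
  define Q where "Q u = scale_x s (cyclic_points 7 q u)" for u
  interpret convex_heptagon Q
    by unfold_locales (simp_all add: Q_def orient_scale_x pos)
  have val: "diag u (scale_x s (fst X), snd X)
      = s * line_form (cyclic_points 7 q u) (cyclic_points 7 q (u + 3)) X" for u X
    by (simp add: diag_def Q_def line_form_scale_x)
  have inv: "(scale_x s (fst (scale_x s (fst X), snd X)), snd (scale_x s (fst X), snd X)) = X" for X
    using s by (auto simp: prod_eq_iff vec_eq_iff forall_2)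
  show ?thesis
  proof (rule that[OF s convex_heptagon_axioms pos])
    show "\<exists>Y. \<forall>u. s * line_form (cyclic_points 7 q u) (cyclic_points 7 q (u + 3)) X = diag u Y" for X
      using val by metis
    show "\<exists>X. \<forall>u. diag u Y = s * line_form (cyclic_points 7 q u) (cyclic_points 7 q (u + 3)) X" for Y
      using val inv by metis
  qed
qed

lemma vertex_cyclic_points:
  assumes "i \<in> {1..7}"
  shows "q i = cyclic_points 7 q (i - 1)"
  using assms by (auto simp: cyclic_points_def)

lemma general_position_if_oriented:
  assumes "\<And>i j k. i < j \<Longrightarrow> j < k \<Longrightarrow> k < i + 7 \<Longrightarrow>
      0 < s * orient (cyclic_points 7 q i) (cyclic_points 7 q j) (cyclic_points 7 q k)"
  shows "general_position q"
proof
  fix i j k :: nat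
  assume ijk: "i \<in> {1..7}" "j \<in> {1..7}" "k \<in> {1..7}" "i \<noteq> j" "i \<noteq> k" "j \<noteq> k"
  have sorted: "orient (q a) (q b) (q c) \<noteq> 0" if "a \<in> {1..7}" "b \<in> {1..7}" "c \<in> {1..7}" "a < b" "b < c" for a b c
  proof -
    have "a - 1 < b - 1" "b - 1 < c - 1" "c - 1 < a - 1 + 7" using that by auto
    then have "0 < s * orient (q a) (q b) (q c)"
      using assms[of "a - 1" "b - 1" "c - 1"] that(1-3) by (simp only: vertex_cyclic_points[of _ q])
    then show ?thesis by auto
  qed
  consider "i < j" "j < k" | "i < k" "k < j" | "j < i" "i < k" | "j < k" "k < i" | "k < i" "i < j" | "k < j" "j < i"
    using ijk by linarith
  then show "orient (q i) (q j) (q k) \<noteq> 0"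
  proof cases
    case 1 then show ?thesis using sorted ijk by blast
  next
    case 2 then show ?thesis using sorted[of i k j] ijk by (metis neg_equal_0_iff_equal orient_rotate orient_swap)
  next
    case 3 then show ?thesis using sorted[of j i k] ijk by (metis neg_equal_0_iff_equal orient_swap)
  next
    case 4 then show ?thesis using sorted[of j k i] ijk by (metis orient_rotate)
  next
    case 5 then show ?thesis using sorted[of k i j] ijk by (metis orient_rotate)
  next
    case 6 then show ?thesis using sorted[of k j i] ijk by (metis neg_equal_0_iff_equal orient_rotate orient_swap)
  qed
qed

text \<open>Of the five vertices off a long diagonal two are on one side of it and three on the other, so
  the denominator of the stress has the sign of the orientation.\<close>

lemma stress_long_edge:
  assumes s: "s = 1 \<or> s = - 1"
    and pos: "\<And>i j k. i < j \<Longrightarrow> j < k \<Longrightarrow> k < i + 7 \<Longrightarrow>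
      0 < s * orient (cyclic_points 7 q i) (cyclic_points 7 q j) (cyclic_points 7 q k)"
  shows "\<exists>w>0. \<forall>X. stress q X (long_edge u)
    = w * (s * line_form (cyclic_points 7 q u) (cyclic_points 7 q (u + 3)) X)"
proof -
  let ?Q = "cyclic_points 7 q"
  define t where "t k = orient (?Q u) (?Q (u + 3)) (?Q (u + k))" for k
  define o' where "o' k = s * t k" for k
  have s2: "s * s = 1" using s by auto
  have off: "{1..7} - long_edge u = (\<lambda>k. (u + k) mod 7 + 1) ` {1, 2, 4, 5, 6}"
    and inj: "inj_on (\<lambda>k. (u + k) mod 7 + 1) {1, 2, 4, 5, 6}" 
    and ends: "u mod 7 \<noteq> (u + 3) mod 7"
  proof -
    define r where "r = u mod 7"
    have red: "(u + k) mod 7 = (r + k) mod 7" for k by (simp add: r_def mod_add_left_eq)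
    have r: "r = 0 \<or> r = 1 \<or> r = 2 \<or> r = 3 \<or> r = 4 \<or> r = 5 \<or> r = 6"
      by (rule less_7_cases) (simp add: r_def)
    have univ: "{1..7::nat} = {1, 2, 3, 4, 5, 6, 7}" by auto
    show "{1..7} - long_edge u = (\<lambda>k. (u + k) mod 7 + 1) ` {1, 2, 4, 5, 6}"
      unfolding long_edge_def red univ r_def[symmetric] using r
      by (elim disjE; hypsubst; simp add: insert_commute insert_Diff_if numeral_2_eq_2[symmetric] numeral_3_eq_3[symmetric])
    show "inj_on (\<lambda>k. (u + k) mod 7 + 1) {1, 2, 4, 5, 6}"
      unfolding red inj_on_def using r by (elim disjE; hypsubst; simp)
    show "u mod 7 \<noteq> (u + 3) mod 7"
      unfolding red r_def[symmetric] using r by (elim disjE; hypsubst; simp)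
  qed
  define D where "D = (\<Prod>l\<in>{1..7} - long_edge u. orient (?Q u) (?Q (u + 3)) (q l))"
  have "D = (\<Prod>k\<in>{1, 2, 4, 5, 6}. t k)"
    unfolding D_def off prod.reindex[OF inj] by (simp add: cyclic_points_def t_def)
  also have "\<dots> = t 1 * t 2 * t 4 * t 5 * t 6" by simp
  also have "\<dots> = s * (o' 1 * o' 2 * o' 4 * o' 5 * o' 6)"
    unfolding o'_def using s2 by algebra
  finally have D: "D = s * (o' 1 * o' 2 * o' 4 * o' 5 * o' 6)" .
  have "t 1 = - orient (?Q u) (?Q (u + 1)) (?Q (u + 3))" "t 2 = - orient (?Q u) (?Q (u + 2)) (?Q (u + 3))"
    unfolding t_def by (simp_all add: orient_eq algebra_simps)
  then have "o' 1 < 0" "o' 2 < 0"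
    using pos[of u "u + 1" "u + 3"] pos[of u "u + 2" "u + 3"] by (simp_all add: o'_def)
  moreover have "0 < o' 4" "0 < o' 5" "0 < o' 6"
    using pos by (simp_all add: o'_def t_def)
  ultimately have P: "0 < o' 1 * o' 2 * o' 4 * o' 5 * o' 6"
    by (simp add: zero_less_mult_iff)
  have "stress q X (long_edge u) = line_form (?Q u) (?Q (u + 3)) X / D" for X
    using stress_eq[of "u mod 7 + 1" "(u + 3) mod 7 + 1" q X] ends
    by (simp add: D_def long_edge_def cyclic_points_def Suc_le_eq less_Suc_eq_le)
  then have "stress q X (long_edge u)
      = 1 / (o' 1 * o' 2 * o' 4 * o' 5 * o' 6) * (s * line_form (?Q u) (?Q (u + 3)) X)" for X
    using s P by (auto simp: D)
  then show ?thesis using P by (intro exI[of _ "1 / (o' 1 * o' 2 * o' 4 * o' 5 * o' 6)"]) simp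
qed

lemma finite_range_long_edge: "finite (range long_edge)"
  unfolding range_long_edge by simp

text \<open>The vectors \<open>p e\<close> stand for the images of the rows in the quotient. All that matters about them
  is that their relations are, up to positive weights, the simultaneous values of the line forms of
  the diagonals.\<close>

locale heptagon_gale_dual = convex_heptagon Q for Q +
  fixes p :: "nat set \<Rightarrow> 'v::euclidean_space" and w :: "nat set \<Rightarrow> real"
  assumes weight_pos: "0 < w (long_edge u)"
    and relation: "(\<Sum>e\<in>range long_edge. a e *\<^sub>R p e) = 0 \<longleftrightarrow>
      (\<exists>Y. \<forall>u. a (long_edge u) = w (long_edge u) * diag u Y)"
begin

lemma diag_mod: "diag (u mod 7) X = diag u X"
proof -
  have "diag (i + 7 * k) X = diag i X" for i k
  proof (induction k)
    case (Suc k)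
    have "i + 7 * Suc k = (i + 7 * k) + 7" by simp
    then show ?case using Suc by (simp only: diag_periodic)
  qed simp
  from this[of "u mod 7" "u div 7"] show ?thesis by simp
qed

lemma long_edge_add_7: "long_edge (u + 7) = long_edge u"
  using long_edge_mod[of "u + 7"] long_edge_mod[of u] by simp

lemma fan: "complete_simplicial_fan (multiassociahedron 2 7) p (span (p ` range long_edge))"
proof (rule complete_simplicial_fanI[OF finite_range_long_edge])
  fix F assume "F \<in> multiassociahedron 2 7"
  then show "F \<subseteq> range long_edge" by (simp only: multiassociahedron_2_7)
next
  fix F G assume "F \<in> multiassociahedron 2 7" "G \<subseteq> F"
  then show "G \<in> multiassociahedron 2 7" unfolding multiassociahedron_2_7 by blast
next
  fix b :: "nat set \<Rightarrow> real"
  define b' where "b' u = b (long_edge u) / w (long_edge u)" for u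
  have "b' (u + 7) = b' u" for u by (simp only: b'_def long_edge_add_7)
  then obtain X where X: "\<And>i. 0 \<le> b' i + diag i X"
      "\<And>i. b' i + diag i X = 0 \<or> b' (i+1) + diag (i+1) X = 0 \<or> b' (i+2) + diag (i+2) X = 0"
    using nonneg_rep_exists[of b'] by metis
  define c where "c e = b e + w e * diag (the_inv_into {..<7} long_edge e) X" for e
  have c: "c (long_edge u) = w (long_edge u) * (b' u + diag u X)" for u
  proof -
    have "the_inv_into {..<7} long_edge (long_edge u) = u mod 7"
      using the_inv_into_f_f[OF inj_on_long_edge, of "u mod 7"] by (simp add: long_edge_mod)
    then show ?thesis using weight_pos[of u] by (simp add: c_def b'_def diag_mod algebra_simps)
  qed
  have "\<forall>e\<in>range long_edge. 0 \<le> c e" using X(1) weight_pos by (auto simp: c less_imp_le)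
  moreover have "{e \<in> range long_edge. c e \<noteq> 0} \<in> multiassociahedron 2 7"
    unfolding multiassociahedron_2_7 using X(2) by (auto simp: c)
  moreover have "(\<Sum>e\<in>range long_edge. (c e - b e) *\<^sub>R p e) = 0"
    unfolding relation
  proof (intro exI allI)
    fix u
    have "w (long_edge u) * b' u = b (long_edge u)" using weight_pos[of u] by (simp add: b'_def)
    then show "c (long_edge u) - b (long_edge u) = w (long_edge u) * diag u X"
      by (simp add: c algebra_simps)
  qed
  then have "(\<Sum>e\<in>range long_edge. c e *\<^sub>R p e) = (\<Sum>e\<in>range long_edge. b e *\<^sub>R p e)"
    by (simp add: scaleR_left_diff_distrib sum_subtractf)
  ultimately show "\<exists>c. (\<forall>e\<in>range long_edge. 0 \<le> c e) \<and> {e \<in> range long_edge. c e \<noteq> 0} \<in> multiassociahedron 2 7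
      \<and> (\<Sum>e\<in>range long_edge. c e *\<^sub>R p e) = (\<Sum>e\<in>range long_edge. b e *\<^sub>R p e)"
    by blast
next
  fix c c' :: "nat set \<Rightarrow> real" and e
  assume nonneg: "\<And>e. e \<in> range long_edge \<Longrightarrow> 0 \<le> c e" "\<And>e. e \<in> range long_edge \<Longrightarrow> 0 \<le> c' e"
    and face: "{e \<in> range long_edge. c e \<noteq> 0} \<in> multiassociahedron 2 7"
      "{e \<in> range long_edge. c' e \<noteq> 0} \<in> multiassociahedron 2 7"
    and sum: "(\<Sum>e\<in>range long_edge. c e *\<^sub>R p e) = (\<Sum>e\<in>range long_edge. c' e *\<^sub>R p e)"
    and e: "e \<in> range long_edge"
  have "(\<Sum>e\<in>range long_edge. (c' e - c e) *\<^sub>R p e) = 0"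
    using sum by (simp add: scaleR_left_diff_distrib sum_subtractf)
  then obtain Y where Y: "\<And>u. c' (long_edge u) - c (long_edge u) = w (long_edge u) * diag u Y"
    unfolding relation by blast
  define d where "d c u = c (long_edge u) / w (long_edge u)" for c :: "nat set \<Rightarrow> real" and u
  have per: "d c (u + 7) = d c u" for c u by (simp only: d_def long_edge_add_7)
  have dpos: "0 \<le> d c u" "0 \<le> d c' u" for u
    using nonneg weight_pos[of u] by (simp_all add: d_def)
  have d0: "d c u = 0 \<longleftrightarrow> c (long_edge u) = 0" for c u
    using weight_pos[of u] by (simp add: d_def)
  have dface: "d c u = 0 \<or> d c (u+1) = 0 \<or> d c (u+2) = 0"
    "d c' u = 0 \<or> d c' (u+1) = 0 \<or> d c' (u+2) = 0" for u
    unfolding d0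
    using face[unfolded multiassociahedron_2_7, THEN conjunct2, THEN spec, of u] by simp_all
  have "d c' u = d c u + diag u Y" for u
    using Y[of u] weight_pos[of u] by (simp add: d_def field_simps)
  then have "Y = 0"
    by (rule nonneg_rep_unique[OF per per dpos dface])
  then show "c e = c' e" using Y e by (auto simp: diag_def line_form_eq)
qed

lemma in_subspace_if_relation:
  assumes "subspace S" and "diag u Y \<noteq> 0"
    and "\<And>v. v < 7 \<Longrightarrow> v \<noteq> u \<Longrightarrow> diag v Y = 0 \<or> p (long_edge v) \<in> S" and "u < 7"
  shows "p (long_edge u) \<in> S"
proof -
  define a where "a e = w e * diag (the_inv_into {..<7} long_edge e) Y" for e
  have a: "a (long_edge v) = w (long_edge v) * diag v Y" for v
  proof -
    have "the_inv_into {..<7} long_edge (long_edge v) = v mod 7"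
      using the_inv_into_f_f[OF inj_on_long_edge, of "v mod 7"] by (simp add: long_edge_mod)
    then show ?thesis by (simp add: a_def diag_mod)
  qed
  have "(\<Sum>e\<in>range long_edge. a e *\<^sub>R p e) = 0"
    unfolding relation using a by blast
  then have "0 = (\<Sum>v<7. a (long_edge v) *\<^sub>R p (long_edge v))"
    unfolding range_long_edge sum.reindex[OF inj_on_long_edge] by simp
  also have "\<dots> = a (long_edge u) *\<^sub>R p (long_edge u) + (\<Sum>v\<in>{..<7} - {u}. a (long_edge v) *\<^sub>R p (long_edge v))"
    using assms(4) by (intro sum.remove) auto
  finally have eq: "a (long_edge u) *\<^sub>R p (long_edge u) = - (\<Sum>v\<in>{..<7} - {u}. a (long_edge v) *\<^sub>R p (long_edge v))"
    by (simp add: eq_neg_iff_add_eq_0)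
  have "a (long_edge v) *\<^sub>R p (long_edge v) \<in> S" if "v \<in> {..<7} - {u}" for v
    using assms(3)[of v] that subspace_0[OF assms(1)] by (auto simp: a intro: subspace_scale[OF assms(1)])
  then have "a (long_edge u) *\<^sub>R p (long_edge u) \<in> S"
    unfolding eq by (intro subspace_neg[OF assms(1)] subspace_sum[OF assms(1)]) 
  then have "(1 / a (long_edge u)) *\<^sub>R a (long_edge u) *\<^sub>R p (long_edge u) \<in> S"
    by (rule subspace_scale[OF assms(1)])
  moreover have "a (long_edge u) \<noteq> 0" using a assms(2) weight_pos[of u] by simp
  ultimately show ?thesis by simp
qed

text \<open>The facet complementary to \<open>{0, 1, 4}\<close> is a basis: the vertices \<open>Q 0\<close>, \<open>Q 4\<close> and \<open>Q 2\<close> give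
  relations that successively express the vectors at \<open>1\<close>, \<open>0\<close> and \<open>4\<close> through the others.\<close>

lemma dim_span: "dim (span (p ` range long_edge)) = 4"
proof -
  define F where "F = long_edge ` {2, 3, 5, 6}"
  have Fmem: "F \<in> multiassociahedron 2 7"
    unfolding multiassociahedron_2_7
  proof (intro conjI allI)
    show "F \<subseteq> range long_edge" unfolding F_def by blast
    have mem: "long_edge v \<in> F \<longleftrightarrow> v mod 7 \<in> {2, 3, 5, 6}" for v
    proof -
      have "long_edge (v mod 7) \<in> long_edge ` {2, 3, 5, 6} \<longleftrightarrow> v mod 7 \<in> {2, 3, 5, 6}"
        by (rule inj_on_image_mem_iff[OF inj_on_long_edge]) auto
      then show ?thesis by (simp only: long_edge_mod F_def)
    qed
    fix u :: nat
    have lt: "u mod 7 < 7" by simp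
    show "long_edge u \<notin> F \<or> long_edge (u + 1) \<notin> F \<or> long_edge (u + 2) \<notin> F"
      unfolding mem mod_add_left_eq[of u 7 1, symmetric] mod_add_left_eq[of u 7 2, symmetric]
      using less_7_cases[OF lt] by (elim disjE) simp_all
  qed
  then have inj: "inj_on p F" and indep: "independent (p ` F)"
    using fan unfolding complete_simplicial_fan_def by blast+
  have "card F = card {2, 3, 5, 6::nat}"
    unfolding F_def by (rule card_image, rule inj_on_subset[OF inj_on_long_edge]) auto
  then have card: "card (p ` F) = 4" using card_image[OF inj] by simp
  have S: "subspace (span (p ` F))" by (rule subspace_span)
  have base: "p (long_edge v) \<in> span (p ` F)" if "v \<in> {2, 3, 5, 6}" for v
    using that by (intro span_base) (auto simp: F_def)
  have per: "Q 7 = Q 0" "Q 8 = Q 1" "Q 9 = Q 2" using periodic[of 0] periodic[of 1] periodic[of 2] by simp_all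
  have diag_points: "diag 0 (Q j, 1) = tri 0 3 j" "diag 1 (Q j, 1) = tri 1 4 j" "diag 4 (Q j, 1) = tri 4 0 j" for j
    using per by (simp_all add: diag_def line_form_point)
  have m1: "p (long_edge 1) \<in> span (p ` F)"
  proof (rule in_subspace_if_relation[OF S, of 1 "(Q 0, 1)"])
    show "diag 1 (Q 0, 1) \<noteq> 0"
      using positive[of 0 1 4] by (simp add: diag_points orient_rotate[symmetric, of "Q 0"] del: One_nat_def)
    show "diag v (Q 0, 1) = 0 \<or> p (long_edge v) \<in> span (p ` F)" if "v < 7" "v \<noteq> 1" for v
      using less_7_cases[OF that(1)] that(2) base[of v] by (auto simp: diag_points)
  qed simp
  have m0: "p (long_edge 0) \<in> span (p ` F)"
  proof (rule in_subspace_if_relation[OF S, of 0 "(Q 4, 1)"])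
    show "diag 0 (Q 4, 1) \<noteq> 0" using positive[of 0 3 4] by (simp add: diag_points)
    show "diag v (Q 4, 1) = 0 \<or> p (long_edge v) \<in> span (p ` F)" if "v < 7" "v \<noteq> 0" for v
      using less_7_cases[OF that(1)] that(2) base[of v] m1 by (auto simp: diag_points)
  qed simp
  have m4: "p (long_edge 4) \<in> span (p ` F)"
  proof (rule in_subspace_if_relation[OF S, of 4 "(Q 2, 1)"])
    show "diag 4 (Q 2, 1) \<noteq> 0"
      using positive[of 0 2 4] by (simp add: diag_points orient_rotate[symmetric, of "Q 4"])
    show "diag v (Q 2, 1) = 0 \<or> p (long_edge v) \<in> span (p ` F)" if "v < 7" "v \<noteq> 4" for v
      using less_7_cases[OF that(1)] that(2) base[of v] m0 m1 by auto
  qed simp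
  have "p (long_edge v) \<in> span (p ` F)" if "v < 7" for v
    using less_7_cases[OF that] base[of v] m0 m1 m4 by auto
  then have "p ` range long_edge \<subseteq> span (p ` F)" unfolding range_long_edge by auto
  moreover have "p ` F \<subseteq> p ` range long_edge" unfolding F_def by blast
  ultimately have "span (p ` range long_edge) = span (p ` F)"
    by (intro subset_antisym span_minimal subspace_span span_mono)
  then show ?thesis using dim_eq_card_independent[OF indep] card by (simp add: dim_span)
qed

end

theorem corollary4p10:
  fixes q :: "nat \<Rightarrow> real^2"
  assumes "convex_position 7 q"
  shows "realizes_as_complete_fan 2 7 (cofactor_row q :: nat set \<Rightarrow> real^4^7)"
proof -
  let ?Q = "cyclic_points 7 q" and ?v = "cofactor_row q :: nat set \<Rightarrow> real^4^7"
  obtain s :: real and Q where s: "s = 1 \<or> s = - 1" and hept: "convex_heptagon Q"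
    and pos: "\<And>i j k. i < j \<Longrightarrow> j < k \<Longrightarrow> k < i + 7 \<Longrightarrow> 0 < s * orient (?Q i) (?Q j) (?Q k)"
    and val: "\<And>X. \<exists>Y. \<forall>u. s * line_form (?Q u) (?Q (u + 3)) X = convex_heptagon.diag Q u Y"
      "\<And>Y. \<exists>X. \<forall>u. convex_heptagon.diag Q u Y = s * line_form (?Q u) (?Q (u + 3)) X"
    by (rule convex_position_heptagon[OF assms]) (rule that)
  interpret convex_heptagon Q by (rule hept)
  interpret general_position q by (rule general_position_if_oriented[OF pos])
  obtain w where w: "\<And>u. 0 < w u"
    "\<And>u X. stress q X (long_edge u) = w u * (s * line_form (?Q u) (?Q (u + 3)) X)"
    using stress_long_edge[OF s pos] by metis
  define weight where "weight e = w (the_inv_into {..<7} long_edge e)" for e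
  have weight: "0 < weight (long_edge u)" for u by (simp add: weight_def w)
  have stress: "stress q X (long_edge u) = weight (long_edge u) * (s * line_form (?Q u) (?Q (u + 3)) X)" for u X
  proof -
    have "the_inv_into {..<7} long_edge (long_edge u) = u mod 7"
      using the_inv_into_f_f[OF inj_on_long_edge, of "u mod 7"] by (simp add: long_edge_mod)
    then have "weight (long_edge u) = w (u mod 7)" by (simp add: weight_def)
    moreover have "?Q (u mod 7) = ?Q u" "?Q (u mod 7 + 3) = ?Q (u + 3)"
      by (simp_all add: cyclic_points_def mod_add_left_eq)
    ultimately show ?thesis using w(2)[of X "u mod 7"] by (simp add: long_edge_mod)
  qed
  let ?short = "{e \<in> edges 7. edge_length 7 e \<le> 2}" and ?long = "range long_edge"
  have edges: "edges 7 = ?short \<union> ?long" "?short \<inter> ?long = {}"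
    unfolding long_edges_eq[symmetric] by auto
  have fin: "finite ?short" "finite ?long" by (simp_all add: finite_range_long_edge)
  have long_sub: "?long \<subseteq> edges 7" using edges(1) by blast
  have split: "sum f (edges 7) = sum f ?short + sum f ?long" for f :: "nat set \<Rightarrow> real^4^7"
    using arg_cong[OF edges(1), of "sum f"] sum.union_disjoint[OF fin edges(2), of f] by (rule trans)
  define W where "W = span (?v ` edges 7)"
  define U where "U = span (?v ` ?short)"
  have "dim (\<pi> ` W) = 4 \<and> complete_simplicial_fan (multiassociahedron 2 7) (\<pi> \<circ> ?v) (\<pi> ` W)"
    if \<pi>: "quotient_map W U \<pi>" for \<pi>
  proof -
    have lin: "linear \<pi>" and ker: "\<And>x. x \<in> W \<Longrightarrow> \<pi> x = 0 \<longleftrightarrow> x \<in> U"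
      using \<pi> unfolding quotient_map_def by auto
    have UW: "U \<subseteq> W" unfolding U_def W_def by (intro span_mono image_mono) auto
    have short0: "\<pi> (?v e) = 0" if "e \<in> ?short" for e
    proof -
      have "?v e \<in> U" unfolding U_def using that by (intro span_base) auto
      then show ?thesis using ker UW by blast
    qed
    have relation: "(\<Sum>e\<in>?long. a e *\<^sub>R (\<pi> \<circ> ?v) e) = 0 \<longleftrightarrow>
      (\<exists>Y. \<forall>u. a (long_edge u) = weight (long_edge u) * diag u Y)" for a
    proof
      assume "(\<Sum>e\<in>?long. a e *\<^sub>R (\<pi> \<circ> ?v) e) = 0"
      then have "\<pi> (\<Sum>e\<in>?long. a e *\<^sub>R ?v e) = 0"
        by (simp add: linear_sum[OF lin] linear_scale[OF lin])
      moreover have "(\<Sum>e\<in>?long. a e *\<^sub>R ?v e) \<in> W"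
        unfolding W_def using long_sub by (intro span_sum span_scale span_base imageI) blast
      ultimately have "(\<Sum>e\<in>?long. a e *\<^sub>R ?v e) \<in> span (?v ` ?short)"
        using ker unfolding U_def by blast
      then obtain b where b: "(\<Sum>e\<in>?long. a e *\<^sub>R ?v e) = (\<Sum>e\<in>?short. b e *\<^sub>R ?v e)"
        by (rule in_span_image[OF fin(1)])
      \<comment> \<open>moving the short rows to the other side gives a relation between all rows\<close>
      define \<omega> where "\<omega> e = (if e \<in> ?long then a e else - b e)" for e
      have "(\<Sum>e\<in>edges 7. \<omega> e *\<^sub>R ?v e) = (\<Sum>e\<in>?short. \<omega> e *\<^sub>R ?v e) + (\<Sum>e\<in>?long. \<omega> e *\<^sub>R ?v e)"
        by (rule split)
      also have "(\<Sum>e\<in>?short. \<omega> e *\<^sub>R ?v e) = (\<Sum>e\<in>?short. - (b e *\<^sub>R ?v e))"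
        by (rule sum.cong) (use edges(2) in \<open>auto simp: \<omega>_def\<close>)
      also have "(\<Sum>e\<in>?long. \<omega> e *\<^sub>R ?v e) = (\<Sum>e\<in>?long. a e *\<^sub>R ?v e)"
        by (rule sum.cong) (auto simp: \<omega>_def)
      finally have "(\<Sum>e\<in>edges 7. \<omega> e *\<^sub>R ?v e) = 0" using b by (simp add: sum_negf)
      then obtain X where X: "\<forall>e\<in>edges 7. \<omega> e = stress q X e"
        using cofactor_row_relation_iff_stress[of \<omega>] by blast
      obtain Y where Y: "\<forall>u. s * line_form (?Q u) (?Q (u + 3)) X = diag u Y" using val(1) by blast
      have "a (long_edge u) = weight (long_edge u) * diag u Y" for u
      proof -
        have "long_edge u \<in> edges 7" using long_sub by blast
        then have "\<omega> (long_edge u) = stress q X (long_edge u)" using X by blast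
        then show ?thesis using Y by (simp add: \<omega>_def stress)
      qed
      then show "\<exists>Y. \<forall>u. a (long_edge u) = weight (long_edge u) * diag u Y" by blast
    next
      assume "\<exists>Y. \<forall>u. a (long_edge u) = weight (long_edge u) * diag u Y"
      then obtain Y where Y: "\<And>u. a (long_edge u) = weight (long_edge u) * diag u Y" by blast
      obtain X where X: "\<And>u. diag u Y = s * line_form (?Q u) (?Q (u + 3)) X" using val(2) by blast
      have a: "a e = stress q X e" if "e \<in> ?long" for e
        using that Y by (auto simp: stress X)
      have "(\<Sum>e\<in>edges 7. stress q X e *\<^sub>R ?v e) = 0"
        by (rule iffD2[OF cofactor_row_relation_iff_stress]) (intro exI[of _ X] ballI refl)
      then have "0 = \<pi> (\<Sum>e\<in>edges 7. stress q X e *\<^sub>R ?v e)"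
        by (simp add: linear_0[OF lin])
      also have "\<dots> = (\<Sum>e\<in>edges 7. stress q X e *\<^sub>R \<pi> (?v e))"
        by (simp add: linear_sum[OF lin] linear_scale[OF lin])
      also have "\<dots> = (\<Sum>e\<in>?short. stress q X e *\<^sub>R \<pi> (?v e)) + (\<Sum>e\<in>?long. stress q X e *\<^sub>R \<pi> (?v e))"
        by (rule split)
      also have "(\<Sum>e\<in>?short. stress q X e *\<^sub>R \<pi> (?v e)) = 0"
        by (rule sum.neutral) (use short0 in auto)
      finally show "(\<Sum>e\<in>?long. a e *\<^sub>R (\<pi> \<circ> ?v) e) = 0" using a by simp
    qed
    interpret heptagon_gale_dual Q "\<pi> \<circ> ?v" weight
      by unfold_locales (use weight relation in auto)
    have "\<pi> ` W = span ((\<pi> \<circ> ?v) ` edges 7)"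
      unfolding W_def image_comp[symmetric] by (rule linear_span_image[OF lin, symmetric])
    also have "\<dots> = span ((\<pi> \<circ> ?v) ` ?long)"
    proof (intro subset_antisym span_minimal subspace_span)
      show "(\<pi> \<circ> ?v) ` edges 7 \<subseteq> span ((\<pi> \<circ> ?v) ` ?long)"
      proof (rule image_subsetI)
        fix e assume "e \<in> edges 7"
        then consider "e \<in> ?short" | "e \<in> ?long" using edges(1) by blast
        then show "(\<pi> \<circ> ?v) e \<in> span ((\<pi> \<circ> ?v) ` ?long)"
        proof cases
          case 1 then show ?thesis using short0 by (simp add: span_zero)
        next
          case 2 then show ?thesis by (intro span_base imageI)
        qed
      qed
      show "(\<pi> \<circ> ?v) ` ?long \<subseteq> span ((\<pi> \<circ> ?v) ` edges 7)"
        using long_sub by (intro order_trans[OF _ span_superset] image_mono) blast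
    qed
    finally show ?thesis using fan dim_span by simp
  qed
  then show ?thesis
    unfolding realizes_as_complete_fan_def Let_def W_def U_def by simp
qed

end
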